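(* Consider the Aztec diamond of size $n\in\mathbb{N}$, and write $n=4p+\alpha$ with $\alpha\in\{0,1,2,3\}$ and $p\in\mathbb{N}$. Colour the Aztec diamond black and white in a chessboard pattern such that the left one of the topmost unit squares is black. Then, after sampling a domino tiling uniformly at random, the probability to find a horizontal domino tile at position $(l,m)\in\mathbb{Z}^2$ whose left unit square is black equals $$\mathbb{P}(l,m;4p+\alpha)=\begin{cases}\dfrac14+2^{-4p-\alpha}\dbinom{2p-1}{p}^2 f_{l,m,\alpha}(p), & \text{if } l+m\equiv\alpha+1 \pmod 2,\\[2mm] 0, & \text{otherwise,}\end{cases}$$ where $f_{l,m,\alpha}(p)$ is a rational function in $p$ (depending only on $l,m,\alpha$).
   Context: $\mathbb{N}=\{0,1,2,\dots\}$. The Aztec diamond of size $n$ is the union of all unit squares $[i,i+1]\times[j,j+1]$ ($i,j\in\mathbb{Z}$) contained in $\{(x,y):|x|+|y|\le n+1\}$, so its centre is at $(0,0)$. A domino is a union of two edge-adjacent unit squares; a domino tiling is a covering of the region by dominoes with pairwise disjoint interiors. A horizontal domino is at position $(l,m)$ if the centre of its lower side is $(l,m)$, i.e. it is $[l-1,l+1]\times[m,m+1]$. $\mathbb{P}(l,m;n)$ denotes the probability that a uniformly random domino tiling of the Aztec diamond of size $n$ contains the horizontal domino at position $(l,m)$ with its left square black.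
   Formalization: The formula is asserted only for positions (l,m) whose domino lies inside the Aztec diamond of size n (outside, the probability is 0 but the formula can fail), and for p=0 the binomial coefficient binom(2p-1,p) is read as 1/2, since the value 1 would give probability 5/4 at l=m=0, n=1. *)

theory Defs
  imports
    "HOL-Probability.Probability"
    "HOL-Computational_Algebra.Polynomial"
    "HOL-Number_Theory.Cong"
begin

text \<open>Lattice squares are named by their lower left corner.\<close>

definition unit_square :: "int \<times> int \<Rightarrow> (real \<times> real) set" where
  "unit_square c =
     {real_of_int (fst c)..real_of_int (fst c) + 1} \<times> {real_of_int (snd c)..real_of_int (snd c) + 1}"

definition aztec_squares :: "nat \<Rightarrow> (int \<times> int) set" where
  "aztec_squares n = {c. unit_square c \<subseteq> {(x, y). \<bar>x\<bar> + \<bar>y\<bar> \<le> real n + 1}}"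

definition aztec_diamond :: "nat \<Rightarrow> (real \<times> real) set" where
  "aztec_diamond n = (\<Union>c\<in>aztec_squares n. unit_square c)"

definition edge_adjacent :: "int \<times> int \<Rightarrow> int \<times> int \<Rightarrow> bool" where
  "edge_adjacent c d \<longleftrightarrow> \<bar>fst c - fst d\<bar> + \<bar>snd c - snd d\<bar> = 1"

definition domino :: "(real \<times> real) set \<Rightarrow> bool" where
  "domino D \<longleftrightarrow> (\<exists>c d. edge_adjacent c d \<and> D = unit_square c \<union> unit_square d)"

definition domino_tiling :: "(real \<times> real) set \<Rightarrow> (real \<times> real) set set \<Rightarrow> bool" where
  "domino_tiling R T \<longleftrightarrow>
     (\<forall>D\<in>T. domino D) \<and> \<Union>T = R \<and> pairwise (\<lambda>D E. interior D \<inter> interior E = {}) T"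

definition horizontal_domino :: "int \<Rightarrow> int \<Rightarrow> (real \<times> real) set" where
  "horizontal_domino l m =
     {real_of_int l - 1..real_of_int l + 1} \<times> {real_of_int m..real_of_int m + 1}"

text \<open>
  For \<open>n \<ge> 1\<close> the topmost squares of the Aztec diamond are \<open>(- 1, n - 1)\<close> and \<open>(0, n - 1)\<close>
  (lemma \<open>topmost_squares\<close>), so the black squares are those at an even number of steps from
  \<open>(- 1, n - 1)\<close>.
\<close>

definition black :: "nat \<Rightarrow> int \<times> int \<Rightarrow> bool" where
  "black n c \<longleftrightarrow> even ((fst c - (- 1)) + (snd c - (int n - 1)))"

definition placement_prob :: "int \<Rightarrow> int \<Rightarrow> nat \<Rightarrow> real" where
  "placement_prob l m n =
     measure_pmf.prob (pmf_of_set {T. domino_tiling (aztec_diamond n) T})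
       {T. horizontal_domino l m \<in> T \<and> black n (l - 1, m)}"

text \<open>
  The coefficient \<open>binom (2p - 1) p\<close>.  For \<open>p = 0\<close> it has to be read as the value of
  \<open>\<Gamma>(2p) / (\<Gamma>(p + 1) \<Gamma>(p))\<close> continued to \<open>p = 0\<close>, that is, \<open>1/2\<close>, so that it is half the central
  binomial coefficient for every \<open>p\<close>.  The convention \<open>binom (-1) 0 = 1\<close> would make the formula
  for the placement probabilities fail: at \<open>l = m = 0\<close>, \<open>n = 4p + 1\<close> the rational factor
  is the constant \<open>2\<close>, which for \<open>p = 0\<close> would give the probability \<open>5/4\<close> instead of \<open>1/2\<close>.
\<close>

definition binom_2p_minus_1 :: "nat \<Rightarrow> real" where
  "binom_2p_minus_1 p = (if p = 0 then 1 / 2 else real ((2 * p - 1) choose p))"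

lemma binom_2p_minus_1_central: "binom_2p_minus_1 p = real ((2 * p) choose p) / 2"
proof (cases p)
  case 0
  then show ?thesis by (simp add: binom_2p_minus_1_def)
next
  case (Suc q)
  have "(2 * p) choose p = ((2 * q + 1) choose q) + ((2 * q + 1) choose Suc q)"
    by (simp add: Suc)
  moreover have "(2 * q + 1) choose q = (2 * q + 1) choose Suc q"
    using binomial_symmetric[of q "2 * q + 1"] by simp
  ultimately show ?thesis
    by (simp add: binom_2p_minus_1_def Suc)
qed

lemma aztec_squares_iff:
  "(i, j) \<in> aztec_squares n \<longleftrightarrow> max \<bar>i\<bar> \<bar>i + 1\<bar> + max \<bar>j\<bar> \<bar>j + 1\<bar> \<le> int n + 1"
proof -
  have corner: "\<bar>real_of_int a\<bar> + \<bar>real_of_int b\<bar> \<le> real n + 1 \<longleftrightarrow> \<bar>a\<bar> + \<bar>b\<bar> \<le> int n + 1" for a b :: int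
  proof -
    have "\<bar>real_of_int a\<bar> + \<bar>real_of_int b\<bar> = real_of_int (\<bar>a\<bar> + \<bar>b\<bar>)" "real n + 1 = real_of_int (int n + 1)"
      by simp_all
    then show ?thesis
      by (simp only: of_int_le_iff)
  qed
  have bound: "\<bar>x\<bar> \<le> real_of_int (max \<bar>a\<bar> \<bar>a + 1\<bar>)"
    if "real_of_int a \<le> x" "x \<le> real_of_int a + 1" for x a
    using that by (cases "a \<ge> 0") auto
  show ?thesis
  proof
    assume "(i, j) \<in> aztec_squares n"
    then have *: "\<bar>x\<bar> + \<bar>y\<bar> \<le> real n + 1"
      if "real_of_int i \<le> x" "x \<le> real_of_int i + 1" "real_of_int j \<le> y" "y \<le> real_of_int j + 1" for x y
      using that unfolding aztec_squares_def unit_square_def mem_Collect_eq subset_iff by fastforce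
    have "\<bar>a\<bar> + \<bar>b\<bar> \<le> int n + 1" if "a \<in> {i, i + 1}" "b \<in> {j, j + 1}" for a b
      using that by (intro corner[THEN iffD1] *) auto
    from this[of i j] this[of "i + 1" j] this[of i "j + 1"] this[of "i + 1" "j + 1"]
    show "max \<bar>i\<bar> \<bar>i + 1\<bar> + max \<bar>j\<bar> \<bar>j + 1\<bar> \<le> int n + 1"
      by (simp add: max_def)
  next
    assume *: "max \<bar>i\<bar> \<bar>i + 1\<bar> + max \<bar>j\<bar> \<bar>j + 1\<bar> \<le> int n + 1"
    have "\<bar>x\<bar> + \<bar>y\<bar> \<le> real n + 1"
      if "real_of_int i \<le> x" "x \<le> real_of_int i + 1" "real_of_int j \<le> y" "y \<le> real_of_int j + 1" for x y
    proof -
      have "\<bar>x\<bar> + \<bar>y\<bar> \<le> real_of_int (max \<bar>i\<bar> \<bar>i + 1\<bar> + max \<bar>j\<bar> \<bar>j + 1\<bar>)"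
        using bound[OF that(1,2)] bound[OF that(3,4)] unfolding of_int_add by (rule add_mono)
      also have "\<dots> \<le> real_of_int (int n + 1)"
        using * by (simp only: of_int_le_iff)
      finally show ?thesis by simp
    qed
    then show "(i, j) \<in> aztec_squares n"
      by (auto simp: aztec_squares_def unit_square_def)
  qed
qed

lemma topmost_squares:
  assumes "n \<ge> 1"
  shows "{c \<in> aztec_squares n. \<forall>d\<in>aztec_squares n. snd d \<le> snd c} = {(- 1, int n - 1), (0, int n - 1)}"
    (is "?L = ?R")
proof
  have top: "(- 1, int n - 1) \<in> aztec_squares n" "(0, int n - 1) \<in> aztec_squares n"
    using assms by (auto simp: aztec_squares_iff)
  have le: "j \<le> int n - 1" if "(i, j) \<in> aztec_squares n" for i j
    using that unfolding aztec_squares_iff by arith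
  have row: "i = - 1 \<or> i = 0" if "(i, int n - 1) \<in> aztec_squares n" for i
    using that assms unfolding aztec_squares_iff by arith
  show "?R \<subseteq> ?L"
    using top le by auto
  show "?L \<subseteq> ?R"
  proof
    fix c assume c: "c \<in> ?L"
    obtain i j where ij: "c = (i, j)" by (cases c)
    have "int n - 1 \<le> j" "(i, j) \<in> aztec_squares n"
      using c top(1) by (auto simp: ij)
    moreover from this have "j = int n - 1"
      using le[of i j] by simp
    ultimately show "c \<in> ?R"
      using row[of i] by (auto simp: ij)
  qed
qed

end

theory Submission
  imports Defs
begin

text \<open>
  The squares of the Aztec diamond of size \<open>n\<close> are covered by \<open>2 \<times> 2\<close> blocks around the lattice
  points \<open>(x, y)\<close> with \<open>\<bar>x\<bar> + \<bar>y\<bar> < n\<close> and \<open>x + y + n\<close> odd, the cells of size \<open>n\<close>.  Every domino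
  inside the diamond of size \<open>n\<close> or of size \<open>n - 1\<close> lies in exactly one of these blocks, and a
  square lies in one block for each of these two diamonds that contains it.  Hence, if in every block
  the set of squares covered by dominoes of that block is replaced by its complement, the coverages
  that come from tilings of size \<open>n\<close> are exchanged with those that come from tilings of size
  \<open>n - 1\<close>.  A coverage determines its tiling up to the two ways to fill each completely covered
  block, and for a tiling of size \<open>n\<close> the number of full blocks minus the number of empty blocks is a
  constant, so the uniform distributions of the two sizes induce the same distribution on coverages
  (\<open>card_matchings_shuffle\<close>).  This is domino shuffling, and it expresses the probability of a
  domino by that of the opposite domino in its block one size earlier plus half of a creation rate
  (\<open>domino_prob_shuffle\<close>, \<open>prob_shuffle\<close>).

  Since the four domino probabilities around a square add up to 1, the creation rate satisfies the
  discrete wave equation with a single initial impulse (\<open>creation_eq_wave\<close>).  Its solution is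
  \<open>2 ^ (- k)\<close> times a product of two Krawtchouk values (\<open>wave_eq_kraw2\<close>).  At a fixed position, and
  on a fixed residue class of \<open>k\<close> modulo 4, each factor is \<open>(- 1) ^ p\<close> times \<open>binom (2p - 1) p\<close> times
  a rational function of \<open>p\<close> (\<open>rational_multiple_kraw\<close>): in the middle column the generating
  function is a power of \<open>1 - z\<^sup>2\<close>, so the values are single binomial coefficients, and a linear
  recurrence leads to the other columns.

  The summand \<open>1/4\<close> comes from symmetry: at a position and its images under reflections the four
  probabilities add up to 1 plus the wave (\<open>hprob_sum_reflections\<close>).  At the origin they are all
  equal, and from there every other position is reached by adding a fixed number of values of the wave
  (\<open>excess_regular\<close>).  All these steps keep track of the first \<open>n\<close> from which on the denominators do
  not vanish; this is the first \<open>n\<close> for which the domino lies inside the diamond.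
\<close>

section \<open>Dominoes, blocks and matchings\<close>

text \<open>
  Combinatorially, a square is its lower left corner, a domino a pair of squares, and a tiling a
  perfect matching of the squares; \<open>tilings_eq_matchings\<close>
  identifies the topological tilings with these matchings.
\<close>

definition dominoes :: "(int \<times> int) set set" where
  "dominoes = {{c, d} | c d. edge_adjacent c d}"

definition matchings :: "(int \<times> int) set \<Rightarrow> (int \<times> int) set set set" where
  "matchings A = {M. M \<subseteq> dominoes \<and> \<Union>M = A \<and> disjoint M}"

text \<open>
  \<open>hdom x y\<close> is the horizontal domino whose lower side has centre \<open>(x, y)\<close>, and \<open>vdom x y\<close> the
  vertical domino whose left side has centre \<open>(x, y)\<close>.  So \<open>hdom x y\<close> and \<open>hdom x (y - 1)\<close> are the
  upper and lower domino of the block around the lattice point \<open>(x, y)\<close>, and \<open>vdom x y\<close> and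
  \<open>vdom (x - 1) y\<close> the right and left one.
\<close>

definition hdom :: "int \<Rightarrow> int \<Rightarrow> (int \<times> int) set" where
  "hdom x y = {(x - 1, y), (x, y)}"

definition vdom :: "int \<Rightarrow> int \<Rightarrow> (int \<times> int) set" where
  "vdom x y = {(x, y - 1), (x, y)}"

fun block :: "int \<times> int \<Rightarrow> (int \<times> int) set" where
  "block (x, y) = {(x - 1, y - 1), (x, y - 1), (x - 1, y), (x, y)}"

fun block_dominoes :: "int \<times> int \<Rightarrow> (int \<times> int) set set" where
  "block_dominoes (x, y) = {hdom x y, hdom x (y - 1), vdom x y, vdom (x - 1) y}"

definition cells :: "nat \<Rightarrow> (int \<times> int) set" where
  "cells n = {(x, y). \<bar>x\<bar> + \<bar>y\<bar> < int n \<and> odd (x + y + int n)}"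

lemma dominoes_cases:
  assumes "D \<in> dominoes"
  obtains x y where "D = hdom x y" | x y where "D = vdom x y"
proof -
  obtain a b c d where D: "D = {(a, b), (c, d)}" and adj: "\<bar>a - c\<bar> + \<bar>b - d\<bar> = 1"
    using assms by (auto simp: dominoes_def edge_adjacent_def)
  consider "c = a + 1" "d = b" | "c = a - 1" "d = b" | "c = a" "d = b + 1" | "c = a" "d = b - 1"
  proof -
    have "(c = a + 1 \<and> d = b) \<or> (c = a - 1 \<and> d = b) \<or> (c = a \<and> d = b + 1) \<or> (c = a \<and> d = b - 1)"
      using adj by presburger
    then show thesis using that by blast
  qed
  then show thesis
  proof cases
    case 1
    then have "D = hdom c b" by (auto simp: D hdom_def)
    then show ?thesis by (rule that)
  next
    case 2
    then have "D = hdom a b" by (auto simp: D hdom_def)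
    then show ?thesis by (rule that)
  next
    case 3
    then have "D = vdom a d" by (auto simp: D vdom_def)
    then show ?thesis by (rule that)
  next
    case 4
    then have "D = vdom a b" by (auto simp: D vdom_def)
    then show ?thesis by (rule that)
  qed
qed

lemma hdom_eq_iff [simp]: "hdom x y = hdom x' y' \<longleftrightarrow> x = x' \<and> y = y'"
  and vdom_eq_iff [simp]: "vdom x y = vdom x' y' \<longleftrightarrow> x = x' \<and> y = y'"
  and hdom_neq_vdom [simp]: "hdom x y \<noteq> vdom x' y'" "vdom x' y' \<noteq> hdom x y"
  by (auto simp: hdom_def vdom_def doubleton_eq_iff)

lemma hdom_in_dominoes [simp]: "hdom x y \<in> dominoes"
  and vdom_in_dominoes [simp]: "vdom x y \<in> dominoes"
  by (force simp: dominoes_def hdom_def vdom_def edge_adjacent_def)+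

lemma finite_cells: "finite (cells n)"
proof (rule finite_subset)
  show "cells n \<subseteq> {- int n..int n} \<times> {- int n..int n}"
    by (auto simp: cells_def)
qed auto

lemma finite_aztec_squares: "finite (aztec_squares n)"
proof (rule finite_subset)
  show "aztec_squares n \<subseteq> {- int n - 1..int n + 1} \<times> {- int n - 1..int n + 1}"
    by (auto simp: aztec_squares_iff)
qed auto

lemma block_dominoes_subset: "block_dominoes c \<subseteq> dominoes"
  by (cases c) auto

lemma finite_block_dominoes: "finite (block_dominoes c)"
  by (cases c) auto

text \<open>
  A domino lies in the two blocks around the midpoints of its long sides.  These are neighbouring
  lattice points, so only one of them has a given parity.
\<close>

lemma block_dominoes_same_parity:
  assumes "odd (x + y + int n)" "odd (x' + y' + int n)" "D \<in> block_dominoes (x, y)" "D \<in> block_dominoes (x', y')"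
  shows "(x, y) = (x', y')"
proof -
  have parity: "even (x + y) \<longleftrightarrow> even (x' + y')" using assms(1,2) by presburger
  have "(x', y') \<in> {(x, y), (x, y - 1), (x, y + 1), (x + 1, y), (x - 1, y)}"
    using assms(3,4) unfolding block_dominoes.simps insert_iff empty_iff
    by (elim disjE) simp_all
  then show ?thesis
    using parity unfolding insert_iff empty_iff by (elim disjE) auto
qed

lemma block_dominoes_disjoint:
  assumes "c \<in> cells n" "c' \<in> cells n" "D \<in> block_dominoes c" "D \<in> block_dominoes c'"
  shows "c = c'"
  using assms block_dominoes_same_parity[of "fst c" "snd c" n "fst c'" "snd c'" D]
  by (simp add: cells_def case_prod_beta)

text \<open>
  Twice the maximum of \<open>\<bar>a\<bar>\<close> and \<open>\<bar>a + 1\<bar>\<close> is \<open>\<bar>a\<bar> + \<bar>a + 1\<bar> + 1\<close>.  In this form the condition is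
  about the sum of the norms of two opposite corners of the square, which are the centres of the two
  blocks of equal parity that contain it.
\<close>

lemma aztec_squares_alt:
  "(i, j) \<in> aztec_squares n \<longleftrightarrow> (\<bar>i\<bar> + \<bar>j\<bar>) + (\<bar>i + 1\<bar> + \<bar>j + 1\<bar>) \<le> 2 * int n"
proof -
  have "max \<bar>a\<bar> \<bar>a + 1\<bar> * 2 = \<bar>a\<bar> + \<bar>a + 1\<bar> + 1" for a :: int
    by (cases "a \<ge> 0") (auto simp: max_def)
  from this[of i] this[of j] show ?thesis
    unfolding aztec_squares_iff by linarith
qed

lemma aztec_domino_in_block:
  assumes "D \<in> dominoes" "D \<subseteq> aztec_squares n"
  shows "\<exists>c\<in>cells n. D \<in> block_dominoes c"
proof (cases rule: dominoes_cases[OF assms(1)])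
  case (1 x y)
  have "(\<bar>x\<bar> + \<bar>y\<bar>) + (\<bar>x + 1\<bar> + \<bar>y + 1\<bar>) \<le> 2 * int n"
    "(\<bar>x - 1\<bar> + \<bar>y\<bar>) + (\<bar>x\<bar> + \<bar>y + 1\<bar>) \<le> 2 * int n"
    using assms(2) aztec_squares_alt[of x y n] aztec_squares_alt[of "x - 1" y n]
    by (auto simp: 1 hdom_def)
  then have *: "\<bar>x\<bar> + \<bar>y\<bar> \<le> int n" "\<bar>x\<bar> + \<bar>y + 1\<bar> \<le> int n" by linarith+
  show ?thesis
  proof (cases "odd (x + y + int n)")
    case True
    then have "\<bar>x\<bar> + \<bar>y\<bar> \<noteq> int n" by presburger
    then have "(x, y) \<in> cells n" using True * by (auto simp: cells_def)
    then show ?thesis by (force simp: 1)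
  next
    case False
    then have "\<bar>x\<bar> + \<bar>y + 1\<bar> \<noteq> int n" by presburger
    then have "(x, y + 1) \<in> cells n" using False * by (auto simp: cells_def)
    then show ?thesis by (force simp: 1)
  qed
next
  case (2 x y)
  have "(\<bar>x\<bar> + \<bar>y\<bar>) + (\<bar>x + 1\<bar> + \<bar>y + 1\<bar>) \<le> 2 * int n"
    "(\<bar>x\<bar> + \<bar>y - 1\<bar>) + (\<bar>x + 1\<bar> + \<bar>y\<bar>) \<le> 2 * int n"
    using assms(2) aztec_squares_alt[of x y n] aztec_squares_alt[of x "y - 1" n]
    by (auto simp: 2 vdom_def)
  then have *: "\<bar>x\<bar> + \<bar>y\<bar> \<le> int n" "\<bar>x + 1\<bar> + \<bar>y\<bar> \<le> int n" by linarith+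
  show ?thesis
  proof (cases "odd (x + y + int n)")
    case True
    then have "\<bar>x\<bar> + \<bar>y\<bar> \<noteq> int n" by presburger
    then have "(x, y) \<in> cells n" using True * by (auto simp: cells_def)
    then show ?thesis by (force simp: 2)
  next
    case False
    then have "\<bar>x + 1\<bar> + \<bar>y\<bar> \<noteq> int n" by presburger
    then have "(x + 1, y) \<in> cells n" using False * by (auto simp: cells_def)
    then show ?thesis by (force simp: 2)
  qed
qed

text \<open>
  The norms of the two opposite corners differ by at most 2 and have the parity of \<open>n - 1\<close>, so their
  sum is at most \<open>2 n\<close> iff one of them is below \<open>n\<close>, and at most \<open>2 n - 2\<close> iff both are.
\<close>

lemma diagonal_cells_square:
  fixes i j :: int
  assumes "n \<ge> 1" "odd (i + j + int n)"
  shows "\<bar>i\<bar> + \<bar>j\<bar> < int n \<or> \<bar>i + 1\<bar> + \<bar>j + 1\<bar> < int n \<longleftrightarrow> (i, j) \<in> aztec_squares n" (is ?A)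
    and "\<bar>i\<bar> + \<bar>j\<bar> < int n \<and> \<bar>i + 1\<bar> + \<bar>j + 1\<bar> < int n \<longleftrightarrow> (i, j) \<in> aztec_squares (n - 1)" (is ?B)
proof -
  define a b where ab: "a = \<bar>i\<bar> + \<bar>j\<bar>" "b = \<bar>i + 1\<bar> + \<bar>j + 1\<bar>"
  have n: "int (n - 1) = int n - 1" using assms by simp
  have "odd (a + int n)" "odd (b + int n)"
    unfolding ab using assms(2) by presburger+
  then have neq: "a \<noteq> int n" "b \<noteq> int n"
    by auto
  have "\<bar>i + 1\<bar> \<le> \<bar>i\<bar> + 1" "\<bar>j + 1\<bar> \<le> \<bar>j\<bar> + 1" "\<bar>i\<bar> \<le> \<bar>i + 1\<bar> + 1" "\<bar>j\<bar> \<le> \<bar>j + 1\<bar> + 1"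
    by linarith+
  then have "a \<le> b + 2" "b \<le> a + 2"
    unfolding ab by linarith+
  with neq have "a < int n \<or> b < int n \<longleftrightarrow> a + b \<le> 2 * int n"
    "a < int n \<and> b < int n \<longleftrightarrow> a + b \<le> 2 * (int n - 1)"
    by (presburger, presburger)
  then show ?A ?B
    unfolding aztec_squares_alt n ab[symmetric] .
qed

lemma antidiagonal_cells_square:
  fixes i j :: int
  assumes "n \<ge> 1" "even (i + j + int n)"
  shows "\<bar>i + 1\<bar> + \<bar>j\<bar> < int n \<or> \<bar>i\<bar> + \<bar>j + 1\<bar> < int n \<longleftrightarrow> (i, j) \<in> aztec_squares n" (is ?A)
    and "\<bar>i + 1\<bar> + \<bar>j\<bar> < int n \<and> \<bar>i\<bar> + \<bar>j + 1\<bar> < int n \<longleftrightarrow> (i, j) \<in> aztec_squares (n - 1)" (is ?B)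
proof -
  have mirror: "(i, - 1 - j) \<in> aztec_squares k \<longleftrightarrow> (i, j) \<in> aztec_squares k" for k
  proof -
    have "\<bar>- 1 - j\<bar> = \<bar>j + 1\<bar>" "\<bar>- 1 - j + 1\<bar> = \<bar>j\<bar>" by linarith+
    then show ?thesis by (simp only: aztec_squares_alt add_ac)
  qed
  have abs_eq: "\<bar>- 1 - j\<bar> = \<bar>j + 1\<bar>" "\<bar>- 1 - j + 1\<bar> = \<bar>j\<bar>" by linarith+
  have "odd (i + (- 1 - j) + int n)" using assms(2) by presburger
  note * = diagonal_cells_square[OF assms(1) this, unfolded mirror abs_eq]
  show ?A using *(1) by blast
  show ?B using *(2) by blast
qed

text \<open>
  Interior squares, those of the smaller diamond, lie in two blocks, and boundary squares in one.
  This is what makes complementation within blocks lead from size \<open>n\<close> to size \<open>n - 1\<close>.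
\<close>

lemma card_blocks_containing:
  assumes "n \<ge> 1"
  shows "card {c \<in> cells n. v \<in> block c} = of_bool (v \<in> aztec_squares n) + of_bool (v \<in> aztec_squares (n - 1))"
proof -
  obtain i j where v: "v = (i, j)" by (cases v)
  define small where "small x y \<longleftrightarrow> \<bar>x\<bar> + \<bar>y\<bar> < int n" for x y :: int
  have cells: "(x, y) \<in> cells n \<longleftrightarrow> small x y \<and> odd (x + y + int n)" for x y
    by (simp add: cells_def small_def)
  have block: "v \<in> block (x, y) \<longleftrightarrow> (x, y) \<in> {(i, j), (i + 1, j), (i, j + 1), (i + 1, j + 1)}" for x y
  proof -
    have "i = x - 1 \<longleftrightarrow> x = i + 1" "i = x \<longleftrightarrow> x = i" "j = y - 1 \<longleftrightarrow> y = j + 1" "j = y \<longleftrightarrow> y = j"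
      by auto
    then show ?thesis
      by (simp only: v block.simps insert_iff empty_iff prod.inject) argo
  qed
  show ?thesis
  proof (cases "odd (i + j + int n)")
    case True
    then have eq: "{c \<in> cells n. v \<in> block c} =
      (if small i j then {(i, j)} else {}) \<union> (if small (i + 1) (j + 1) then {(i + 1, j + 1)} else {})"
      by (auto simp: cells block simp del: block.simps)
    show ?thesis
      unfolding eq unfolding v diagonal_cells_square[OF assms True, folded small_def, symmetric]
      by (cases "small i j"; cases "small (i + 1) (j + 1)") simp_all
  next
    case False
    then have even: "even (i + j + int n)" by simp
    then have eq: "{c \<in> cells n. v \<in> block c} =
      (if small (i + 1) j then {(i + 1, j)} else {}) \<union> (if small i (j + 1) then {(i, j + 1)} else {})"
      by (auto simp: cells block simp del: block.simps)
    show ?thesis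
      unfolding eq unfolding v antidiagonal_cells_square[OF assms even, folded small_def, symmetric]
      by (cases "small (i + 1) j"; cases "small i (j + 1)") simp_all
  qed
qed

section \<open>States of a single block\<close>

text \<open>
  The dominoes of a tiling that lie in one block form one of seven sets: none, one of the four
  dominoes, or two parallel ones.
\<close>

definition states :: "int \<times> int \<Rightarrow> (int \<times> int) set set set" where
  "states c = {s. s \<subseteq> block_dominoes c \<and> disjoint s}"

lemma block_dominoes_overlap:
  "hdom x y \<inter> hdom x (y - 1) = {}" "vdom x y \<inter> vdom (x - 1) y = {}"
  "hdom x y \<inter> vdom x y \<noteq> {}" "hdom x y \<inter> vdom (x - 1) y \<noteq> {}"
  "hdom x (y - 1) \<inter> vdom x y \<noteq> {}" "hdom x (y - 1) \<inter> vdom (x - 1) y \<noteq> {}"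
  by (auto simp: hdom_def vdom_def)

lemma block_dominoes_union:
  "hdom x y \<union> hdom x (y - 1) = block (x, y)" "vdom x y \<union> vdom (x - 1) y = block (x, y)"
  by (auto simp: hdom_def vdom_def)

lemma subset_doubletonD: "A \<subseteq> {a, b} \<Longrightarrow> A = {} \<or> A = {a} \<or> A = {b} \<or> A = {a, b}"
  by blast

lemma states_eq:
  "states (x, y) = {{}, {hdom x y}, {hdom x (y - 1)}, {vdom x y}, {vdom (x - 1) y},
     {hdom x y, hdom x (y - 1)}, {vdom x y, vdom (x - 1) y}}" (is "_ = ?R")
proof
  show "?R \<subseteq> states (x, y)"
    using block_dominoes_overlap(1,2)[of x y] by (auto simp: states_def disjoint_def)
  show "states (x, y) \<subseteq> ?R"
  proof
    fix s assume "s \<in> states (x, y)"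
    then have sub: "s \<subseteq> {hdom x y, hdom x (y - 1), vdom x y, vdom (x - 1) y}"
      and dis: "\<And>D E. D \<in> s \<Longrightarrow> E \<in> s \<Longrightarrow> D \<noteq> E \<Longrightarrow> D \<inter> E = {}"
      by (auto simp: states_def disjoint_def)
    have "\<not> (hdom a b \<in> s \<and> vdom a' b' \<in> s)" if "hdom a b \<inter> vdom a' b' \<noteq> {}" for a b a' b'
      using dis[OF _ _ hdom_neq_vdom(1), of a b a' b'] that by auto
    note excl = block_dominoes_overlap(3-)[of x y, THEN this]
    show "s \<in> ?R"
    proof (cases "hdom x y \<in> s \<or> hdom x (y - 1) \<in> s")
      case True
      with excl have "vdom x y \<notin> s" "vdom (x - 1) y \<notin> s" by argo+
      moreover have "s \<subseteq> {vdom x y, vdom (x - 1) y, hdom x y, hdom x (y - 1)}"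
        using sub by (simp add: insert_commute)
      ultimately have "s \<subseteq> {hdom x y, hdom x (y - 1)}" by (simp add: subset_insert)
      from subset_doubletonD[OF this] show ?thesis by (elim disjE) simp_all
    next
      case False
      with sub have "s \<subseteq> {vdom x y, vdom (x - 1) y}" by (simp add: subset_insert)
      from subset_doubletonD[OF this] show ?thesis by (elim disjE) simp_all
    qed
  qed
qed

text \<open>
  Different states cover different sets of squares, except that the whole block is covered both by two
  horizontal and by two vertical dominoes.
\<close>

definition coverages :: "int \<times> int \<Rightarrow> (int \<times> int) set set" where
  "coverages c = insert {} (insert (block c) (block_dominoes c))"

lemma card_block: "card (block c) = 4"
  and card_hdom: "card (hdom a b) = 2" and card_vdom: "card (vdom a b) = 2"
  by (cases c) (simp_all add: hdom_def vdom_def)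

lemma block_neq:
  "block c \<noteq> {}" "block c \<noteq> hdom a b" "block c \<noteq> vdom a b" "hdom a b \<noteq> {}" "vdom a b \<noteq> {}"
  using card_block[of c] card_hdom[of a b] card_vdom[of a b]
  by (auto simp del: block.simps)

lemma Union_states: "Union ` states c = coverages c"
  by (cases c) (auto simp: states_eq coverages_def block_dominoes_union simp del: block.simps)

lemma card_states_coverage:
  assumes "X \<in> coverages c"
  shows "card {s \<in> states c. \<Union>s = X} = (if X = block c then 2 else 1)"
proof -
  obtain x y where c: "c = (x, y)" by (cases c)
  note [simp] = block_neq block_neq[symmetric] and [simp del] = block.simps
  have neq: "{hdom x y, hdom x (y - 1)} \<noteq> {vdom x y, vdom (x - 1) y}" by (simp add: doubleton_eq_iff)
  have filter_insert: "{s \<in> insert a A. P s} = (if P a then insert a {s \<in> A. P s} else {s \<in> A. P s})"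
    for a A and P :: "(int \<times> int) set set \<Rightarrow> bool"
    by auto
  have "X \<in> {{}, block (x, y), hdom x y, hdom x (y - 1), vdom x y, vdom (x - 1) y}"
    using assms by (simp add: c coverages_def)
  then show ?thesis
    unfolding c states_eq filter_insert
    by (elim insertE emptyE) (simp_all add: block_dominoes_union neq)
qed

lemma coverages_compl:
  assumes "X \<in> coverages c"
  shows "X \<subseteq> block c" "block c - X \<in> coverages c"
proof -
  obtain x y where c: "c = (x, y)" by (cases c)
  have compl: "block (x, y) - hdom x y = hdom x (y - 1)" "block (x, y) - hdom x (y - 1) = hdom x y"
    "block (x, y) - vdom x y = vdom (x - 1) y" "block (x, y) - vdom (x - 1) y = vdom x y"
    by (simp_all add: hdom_def vdom_def insert_Diff_if insert_commute)
  have X: "X \<in> {{}, block (x, y), hdom x y, hdom x (y - 1), vdom x y, vdom (x - 1) y}"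
    using assms by (simp add: c coverages_def)
  then show "block c - X \<in> coverages c"
    unfolding c by (elim insertE emptyE) (simp_all add: compl coverages_def del: block.simps)
  show "X \<subseteq> block c"
    using X unfolding c by (elim insertE emptyE) (simp_all add: hdom_def vdom_def)
qed

lemma card_coverage:
  assumes "X \<in> coverages c"
  shows "card X + 2 * of_bool (X = {}) = 2 + 2 * of_bool (X = block c)"
  using assms
  by (cases c) (auto simp: coverages_def block_neq block_neq[symmetric] card_block card_hdom card_vdom
      simp del: block.simps)

lemma finite_states: "finite (states c)"
  by (rule finite_subset[of _ "Pow (block_dominoes c)"]) (auto simp: states_def finite_block_dominoes)

lemma finite_coverages: "finite (coverages c)"
  by (simp add: coverages_def finite_block_dominoes)

text \<open>
  Independent local choices, counted by the family \<open>\<kappa>\<close> of their local invariants \<open>g\<close>: if the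
  global constraint \<open>R\<close> sees the choices only through \<open>\<kappa>\<close>, then the number of choices for given
  \<open>\<kappa>\<close> is a product of local numbers.
\<close>

lemma card_PiE_fibres:
  assumes "finite C" "\<And>c. c \<in> C \<Longrightarrow> finite (S c)"
  shows "card {f \<in> PiE C S. R (\<lambda>c\<in>C. g (f c))} =
    (\<Sum>\<kappa> \<in> {\<kappa> \<in> PiE C (\<lambda>c. g ` S c). R \<kappa>}. \<Prod>c\<in>C. card {s \<in> S c. g s = \<kappa> c})"
proof -
  define K where "K = {\<kappa> \<in> PiE C (\<lambda>c. g ` S c). R \<kappa>}"
  have "finite (PiE C (\<lambda>c. g ` S c))" using assms by (intro finite_PiE) auto
  then have finK: "finite K" by (simp add: K_def)
  have fib: "{f \<in> PiE C S. (\<lambda>c\<in>C. g (f c)) = \<kappa>} = PiE C (\<lambda>c. {s \<in> S c. g s = \<kappa> c})" if "\<kappa> \<in> K" for \<kappa>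
  proof (intro equalityI subsetI)
    fix f assume "f \<in> {f \<in> PiE C S. (\<lambda>c\<in>C. g (f c)) = \<kappa>}"
    then show "f \<in> PiE C (\<lambda>c. {s \<in> S c. g s = \<kappa> c})"
      by (auto simp: PiE_iff)
  next
    fix f assume f: "f \<in> PiE C (\<lambda>c. {s \<in> S c. g s = \<kappa> c})"
    have "\<kappa> \<in> extensional C" using that by (auto simp: K_def PiE_iff)
    then have "(\<lambda>c\<in>C. g (f c)) = \<kappa>"
      using f by (auto simp: PiE_iff extensional_def restrict_def)
    then show "f \<in> {f \<in> PiE C S. (\<lambda>c\<in>C. g (f c)) = \<kappa>}"
      using f by (auto simp: PiE_iff)
  qed
  have "{f \<in> PiE C S. R (\<lambda>c\<in>C. g (f c))} = (\<Union>\<kappa>\<in>K. {f \<in> PiE C S. (\<lambda>c\<in>C. g (f c)) = \<kappa>})"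
    by (auto simp: K_def intro!: imageI dest: PiE_mem)
  also have "card \<dots> = (\<Sum>\<kappa>\<in>K. card {f \<in> PiE C S. (\<lambda>c\<in>C. g (f c)) = \<kappa>})"
    using finK assms by (intro card_UN_disjoint) (auto intro!: finite_subset[OF _ finite_PiE[of C S]])
  also have "\<dots> = (\<Sum>\<kappa>\<in>K. \<Prod>c\<in>C. card {s \<in> S c. g s = \<kappa> c})"
    by (intro sum.cong refl) (simp add: fib card_PiE assms(1))
  finally show ?thesis by (simp add: K_def)
qed

section \<open>Domino shuffling as complementation of coverages\<close>

text \<open>From here on, lattice points and blocks are treated as atoms.\<close>

declare split_paired_All [simp del] split_paired_Ex [simp del]
declare block.simps [simp del] block_dominoes.simps [simp del]

definition exact_cover :: "(int \<times> int) set \<Rightarrow> (int \<times> int \<Rightarrow> (int \<times> int) set) \<Rightarrow> (int \<times> int) set \<Rightarrow> bool" where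
  "exact_cover C \<kappa> A \<longleftrightarrow> (\<forall>v. card {c \<in> C. v \<in> \<kappa> c} = of_bool (v \<in> A))"

text \<open>
  Every domino inside \<open>A\<close> belongs to exactly one block, so a matching is a choice of one state per
  block; the matching condition only says how often each square is covered in total.
\<close>

lemma matchings_configurations:
  assumes cover: "\<And>D. D \<in> dominoes \<Longrightarrow> D \<subseteq> A \<Longrightarrow> \<exists>c\<in>cells n. D \<in> block_dominoes c"
  shows "bij_betw (\<lambda>M. \<lambda>c\<in>cells n. M \<inter> block_dominoes c) (matchings A)
    {f \<in> PiE (cells n) states. exact_cover (cells n) (\<lambda>c\<in>cells n. \<Union>(f c)) A}"
    (is "bij_betw ?\<Phi> _ ?F")
proof (rule bij_betw_byWitness[where f' = "\<lambda>f. \<Union>c\<in>cells n. f c"])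
  show "\<forall>M\<in>matchings A. (\<Union>c\<in>cells n. ?\<Phi> M c) = M"
  proof
    fix M assume M: "M \<in> matchings A"
    have "\<exists>c\<in>cells n. D \<in> block_dominoes c" if "D \<in> M" for D
      using M that by (intro cover) (auto simp: matchings_def)
    then show "(\<Union>c\<in>cells n. ?\<Phi> M c) = M" by fastforce
  qed
  show "\<forall>f\<in>?F. ?\<Phi> (\<Union>c\<in>cells n. f c) = f"
  proof
    fix f assume f: "f \<in> ?F"
    then have sub: "f c \<subseteq> block_dominoes c" if "c \<in> cells n" for c
      using that by (auto simp: PiE_iff states_def)
    have "(\<Union>c'\<in>cells n. f c') \<inter> block_dominoes c = f c" if c: "c \<in> cells n" for c
    proof (intro equalityI subsetI)
      fix D assume "D \<in> (\<Union>c'\<in>cells n. f c') \<inter> block_dominoes c"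
      then obtain c' where c': "c' \<in> cells n" "D \<in> f c'" "D \<in> block_dominoes c" by auto
      then have "c' = c" using sub[OF c'(1)] c by (intro block_dominoes_disjoint[of c' n c D]) auto
      with c' show "D \<in> f c" by simp
    qed (use sub[OF c] c in auto)
    then have "?\<Phi> (\<Union>c\<in>cells n. f c) = (\<lambda>c\<in>cells n. f c)"
      by (intro restrict_ext)
    also have "\<dots> = f"
      using f by (intro extensional_restrict) (simp add: PiE_iff)
    finally show "?\<Phi> (\<Union>c\<in>cells n. f c) = f" .
  qed
  show "?\<Phi> ` matchings A \<subseteq> ?F"
  proof (rule image_subsetI)
    fix M assume M: "M \<in> matchings A"
    have empty: "{c \<in> cells n. v \<in> \<Union>(M \<inter> block_dominoes c)} = {}" if "v \<notin> A" for v
      using M that by (auto simp: matchings_def)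
    have ex: "\<exists>c. {c \<in> cells n. v \<in> \<Union>(M \<inter> block_dominoes c)} = {c}" if v: "v \<in> A" for v
    proof -
      obtain D where D: "D \<in> M" "v \<in> D" using M v by (auto simp: matchings_def)
      with M have "D \<in> dominoes" "D \<subseteq> A" by (auto simp: matchings_def)
      from cover[OF this] obtain c where c: "c \<in> cells n" "D \<in> block_dominoes c" by blast
      have "c' = c" if "c' \<in> cells n" "D' \<in> M" "v \<in> D'" "D' \<in> block_dominoes c'" for c' D'
      proof -
        have "disjoint M" using M by (simp add: matchings_def)
        then have "D' = D" using that D by (auto simp: disjoint_def)
        with that c show ?thesis by (intro block_dominoes_disjoint[of c' n c D]) auto
      qed
      then have "{c \<in> cells n. v \<in> \<Union>(M \<inter> block_dominoes c)} \<subseteq> {c}" by blast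
      moreover have "c \<in> {c \<in> cells n. v \<in> \<Union>(M \<inter> block_dominoes c)}" using c D by blast
      ultimately show ?thesis by blast
    qed
    have "card {c \<in> cells n. v \<in> \<Union>(M \<inter> block_dominoes c)} = of_bool (v \<in> A)" for v
    proof (cases "v \<in> A")
      case True
      then obtain c where c: "{c \<in> cells n. v \<in> \<Union>(M \<inter> block_dominoes c)} = {c}"
        using ex by blast
      show ?thesis unfolding c using True by simp
    next
      case False
      then show ?thesis unfolding empty[OF False] by simp
    qed
    then have "exact_cover (cells n) (\<lambda>c\<in>cells n. \<Union>(?\<Phi> M c)) A"
      by (simp add: exact_cover_def cong: conj_cong)
    moreover have "?\<Phi> M \<in> PiE (cells n) states"
      using M by (auto simp: matchings_def states_def disjoint_def)
    ultimately show "?\<Phi> M \<in> ?F" by simp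
  qed
  show "(\<lambda>f. \<Union>c\<in>cells n. f c) ` ?F \<subseteq> matchings A"
  proof (rule image_subsetI)
    fix f assume f: "f \<in> ?F"
    have st: "f c \<in> states c" if "c \<in> cells n" for c using f that by (auto simp: PiE_iff)
    have card: "card {c \<in> cells n. v \<in> \<Union>(f c)} = of_bool (v \<in> A)" for v
      using f by (simp add: exact_cover_def cong: conj_cong)
    have fin: "finite {c \<in> cells n. v \<in> \<Union>(f c)}" for v
      using finite_cells by simp
    have "v \<in> A \<longleftrightarrow> (\<exists>c\<in>cells n. v \<in> \<Union>(f c))" for v
    proof -
      have "v \<notin> A \<longleftrightarrow> {c \<in> cells n. v \<in> \<Union>(f c)} = {}"
        using card_0_eq[OF fin, of v] unfolding card by simp
      then show ?thesis by blast
    qed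
    then have "\<Union>(\<Union>c\<in>cells n. f c) = A" by blast
    moreover have "(\<Union>c\<in>cells n. f c) \<subseteq> dominoes"
      using st block_dominoes_subset by (force simp: states_def)
    moreover have "disjoint (\<Union>c\<in>cells n. f c)"
    proof (rule disjointI)
      fix D D' assume D: "D \<in> (\<Union>c\<in>cells n. f c)" "D' \<in> (\<Union>c\<in>cells n. f c)" "D \<noteq> D'"
      show "D \<inter> D' = {}"
      proof (rule ccontr)
        assume "D \<inter> D' \<noteq> {}"
        then obtain v where v: "v \<in> D" "v \<in> D'" by auto
        obtain c c' where c: "c \<in> cells n" "D \<in> f c" "c' \<in> cells n" "D' \<in> f c'" using D by auto
        have "card {c \<in> cells n. v \<in> \<Union>(f c)} \<le> Suc 0" unfolding card by simp
        then have "c1 = c2" if "c1 \<in> {c \<in> cells n. v \<in> \<Union>(f c)}" "c2 \<in> {c \<in> cells n. v \<in> \<Union>(f c)}" for c1 c2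
          using card_le_Suc0_iff_eq[OF fin] that by blast
        then have "c' = c" using c v by blast
        moreover have "disjoint (f c)" using st[OF c(1)] by (simp add: states_def)
        ultimately have "D \<inter> D' = {}" using c D(3) by (intro disjointD) auto
        then show False using v by blast
      qed
    qed
    ultimately show "(\<Union>c\<in>cells n. f c) \<in> matchings A" by (simp add: matchings_def)
  qed
qed

text \<open>
  A full block can be filled in two ways and every other coverage in one way.
\<close>

lemma card_matchings_by_coverage:
  assumes cover: "\<And>D. D \<in> dominoes \<Longrightarrow> D \<subseteq> A \<Longrightarrow> \<exists>c\<in>cells n. D \<in> block_dominoes c"
  shows "card {M \<in> matchings A. Q (\<lambda>c\<in>cells n. \<Union>(M \<inter> block_dominoes c))} =
    (\<Sum>\<kappa> \<in> {\<kappa> \<in> PiE (cells n) coverages. exact_cover (cells n) \<kappa> A \<and> Q \<kappa>}.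
       2 ^ card {c \<in> cells n. \<kappa> c = block c})"
proof -
  define \<Phi> where "\<Phi> = (\<lambda>M. \<lambda>c\<in>cells n. M \<inter> block_dominoes c)"
  define F where "F = {f \<in> PiE (cells n) states. exact_cover (cells n) (\<lambda>c\<in>cells n. \<Union>(f c)) A}"
  have bij: "bij_betw \<Phi> (matchings A) F"
    unfolding \<Phi>_def F_def using matchings_configurations[OF cover] .
  have cov: "(\<lambda>c\<in>cells n. \<Union>(\<Phi> M c)) = (\<lambda>c\<in>cells n. \<Union>(M \<inter> block_dominoes c))" for M
    by (simp add: \<Phi>_def cong: restrict_cong)
  have "card {M \<in> matchings A. Q (\<lambda>c\<in>cells n. \<Union>(M \<inter> block_dominoes c))} =
    card (\<Phi> ` {M \<in> matchings A. Q (\<lambda>c\<in>cells n. \<Union>(M \<inter> block_dominoes c))})"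
    using bij by (intro card_image[symmetric]) (auto simp: bij_betw_def inj_on_def)
  also have "\<Phi> ` {M \<in> matchings A. Q (\<lambda>c\<in>cells n. \<Union>(M \<inter> block_dominoes c))} =
    {f \<in> F. Q (\<lambda>c\<in>cells n. \<Union>(f c))}"
    using bij by (auto simp: bij_betw_def cov[symmetric])
  also have "\<dots> = {f \<in> PiE (cells n) states. exact_cover (cells n) (\<lambda>c\<in>cells n. \<Union>(f c)) A \<and> Q (\<lambda>c\<in>cells n. \<Union>(f c))}"
    by (auto simp: F_def)
  also have "card \<dots> = (\<Sum>\<kappa> \<in> {\<kappa> \<in> PiE (cells n) (\<lambda>c. Union ` states c). exact_cover (cells n) \<kappa> A \<and> Q \<kappa>}.
       \<Prod>c\<in>cells n. card {s \<in> states c. \<Union>s = \<kappa> c})"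
    by (rule card_PiE_fibres[where R = "\<lambda>\<kappa>. exact_cover (cells n) \<kappa> A \<and> Q \<kappa>"]) (auto intro: finite_cells finite_states)
  also have "\<dots> = (\<Sum>\<kappa> \<in> {\<kappa> \<in> PiE (cells n) coverages. exact_cover (cells n) \<kappa> A \<and> Q \<kappa>}.
       2 ^ card {c \<in> cells n. \<kappa> c = block c})"
    unfolding Union_states
  proof (rule sum.cong[OF refl])
    fix \<kappa> assume "\<kappa> \<in> {\<kappa> \<in> PiE (cells n) coverages. exact_cover (cells n) \<kappa> A \<and> Q \<kappa>}"
    then have "(\<Prod>c\<in>cells n. card {s \<in> states c. \<Union>s = \<kappa> c}) = (\<Prod>c\<in>cells n. if \<kappa> c = block c then 2 else 1)"
      by (intro prod.cong refl card_states_coverage) auto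
    also have "\<dots> = 2 ^ card {c \<in> cells n. \<kappa> c = block c}"
      by (simp add: prod.If_cases finite_cells Int_def)
    finally show "(\<Prod>c\<in>cells n. card {s \<in> states c. \<Union>s = \<kappa> c}) = 2 ^ card {c \<in> cells n. \<kappa> c = block c}" .
  qed
  finally show ?thesis .
qed

text \<open>
  A square in \<open>j\<close> blocks is covered \<open>i\<close> times by \<open>\<kappa>\<close> iff it is covered \<open>j - i\<close> times by the
  complements, and \<open>j\<close> is the number of the two diamonds that contain the square.
\<close>

lemma exact_cover_compl:
  assumes "n \<ge> 1" "\<kappa> \<in> PiE (cells n) coverages"
  shows "exact_cover (cells n) (\<lambda>c\<in>cells n. block c - \<kappa> c) (aztec_squares (n - 1)) \<longleftrightarrow>
    exact_cover (cells n) \<kappa> (aztec_squares n)"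
proof -
  have sum: "card {c \<in> cells n. v \<in> (\<lambda>c\<in>cells n. block c - \<kappa> c) c} + card {c \<in> cells n. v \<in> \<kappa> c}
    = of_bool (v \<in> aztec_squares n) + of_bool (v \<in> aztec_squares (n - 1))" for v
  proof -
    have "\<kappa> c \<subseteq> block c" if "c \<in> cells n" for c
      using assms(2) that coverages_compl(1) by (auto simp: PiE_iff)
    then have "{c \<in> cells n. v \<in> block c} =
      {c \<in> cells n. v \<in> (\<lambda>c\<in>cells n. block c - \<kappa> c) c} \<union> {c \<in> cells n. v \<in> \<kappa> c}"
      by auto
    moreover have "card \<dots> = card {c \<in> cells n. v \<in> (\<lambda>c\<in>cells n. block c - \<kappa> c) c} + card {c \<in> cells n. v \<in> \<kappa> c}"
      by (rule card_Un_disjoint) (auto simp: finite_cells)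
    ultimately show ?thesis using card_blocks_containing[OF assms(1), of v] by simp
  qed
  have "card {c \<in> cells n. v \<in> (\<lambda>c\<in>cells n. block c - \<kappa> c) c} = of_bool (v \<in> aztec_squares (n - 1)) \<longleftrightarrow>
    card {c \<in> cells n. v \<in> \<kappa> c} = of_bool (v \<in> aztec_squares n)" for v
    using sum[of v] by linarith
  then show ?thesis
    unfolding exact_cover_def by (rule all_cong1)
qed

text \<open>
  A block contributes 0, 2 or 4 covered squares, that is, 2 more for a full block and 2 fewer for an
  empty one, and the total is the number of squares of \<open>A\<close>.  So the difference between the numbers of
  full and of empty blocks does not depend on \<open>\<kappa>\<close>.
\<close>

lemma exact_cover_excess:
  assumes "finite A" "\<kappa> \<in> PiE (cells n) coverages" "exact_cover (cells n) \<kappa> A"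
  shows "card A + 2 * card {c \<in> cells n. \<kappa> c = {}} = 2 * card (cells n) + 2 * card {c \<in> cells n. \<kappa> c = block c}"
proof -
  have sub: "\<kappa> c \<subseteq> A" if "c \<in> cells n" for c
  proof
    fix v assume "v \<in> \<kappa> c"
    then have "{c \<in> cells n. v \<in> \<kappa> c} \<noteq> {}" using that by blast
    moreover have "finite {c \<in> cells n. v \<in> \<kappa> c}" by (simp add: finite_cells)
    ultimately have "card {c \<in> cells n. v \<in> \<kappa> c} \<noteq> 0" by (simp only: card_0_eq not_False_eq_True)
    moreover have "card {c \<in> cells n. v \<in> \<kappa> c} = of_bool (v \<in> A)"
      using assms(3) by (simp only: exact_cover_def)
    ultimately show "v \<in> A" by (simp only: of_bool_eq_0_iff not_not)
  qed
  have "card A = (\<Sum>v\<in>A. card {c \<in> cells n. v \<in> \<kappa> c})"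
    using assms(3) by (simp add: exact_cover_def)
  also have "\<dots> = (\<Sum>c\<in>cells n. card {v \<in> A. v \<in> \<kappa> c})"
    using sum.swap_restrict[OF assms(1) finite_cells, where g = "\<lambda>_ _. 1::nat" and R = "\<lambda>v c. v \<in> \<kappa> c"] by simp
  also have "\<dots> = (\<Sum>c\<in>cells n. card (\<kappa> c))"
    by (intro sum.cong refl arg_cong[of _ _ card]) (use sub in auto)
  finally have "card A + 2 * card {c \<in> cells n. \<kappa> c = {}} = (\<Sum>c\<in>cells n. card (\<kappa> c) + 2 * of_bool (\<kappa> c = {}))"
    by (simp add: sum.distrib sum_distrib_left[symmetric] finite_cells of_bool_def sum.If_cases Int_def)
  also have "\<dots> = (\<Sum>c\<in>cells n. 2 + 2 * of_bool (\<kappa> c = block c))"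
    using assms(2) by (intro sum.cong refl card_coverage) auto
  also have "\<dots> = 2 * card (cells n) + 2 * card {c \<in> cells n. \<kappa> c = block c}"
    unfolding sum.distrib sum_distrib_left[symmetric]
    by (simp add: finite_cells of_bool_def sum.If_cases Int_def)
  finally show ?thesis .
qed

lemma aztec_squares_mono: "aztec_squares (n - 1) \<subseteq> aztec_squares n"
proof
  fix c assume "c \<in> aztec_squares (n - 1)"
  moreover obtain i j where "c = (i, j)" by (cases c)
  ultimately show "c \<in> aztec_squares n" by (simp add: aztec_squares_alt)
qed

text \<open>
  Domino shuffling.  A coverage \<open>\<kappa>\<close> has \<open>2 ^ full\<close> matchings of size \<open>n\<close>, and its complement has
  \<open>2 ^ empty\<close> matchings of size \<open>n - 1\<close>, where full and empty refer to the blocks of \<open>\<kappa>\<close>.  The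
  quotient of these numbers is the same constant \<open>\<rho>\<close> for all \<open>\<kappa>\<close>.
\<close>

lemma card_matchings_shuffle:
  assumes "n \<ge> 1"
  obtains \<rho> :: real where "\<rho> > 0"
    "\<And>Q. real (card {M \<in> matchings (aztec_squares n). Q (\<lambda>c\<in>cells n. \<Union>(M \<inter> block_dominoes c))}) =
      \<rho> * real (card {M \<in> matchings (aztec_squares (n - 1)). Q (\<lambda>c\<in>cells n. block c - \<Union>(M \<inter> block_dominoes c))})"
proof -
  define C where "C = cells n"
  define h where "h = card (aztec_squares n) div 2"
  define \<rho> :: real where "\<rho> = 2 ^ h / 2 ^ card C"
  define compl where "compl \<kappa> = (\<lambda>c\<in>C. block c - \<kappa> c)" for \<kappa>
  have main: "real (card {M \<in> matchings (aztec_squares n). Q (\<lambda>c\<in>C. \<Union>(M \<inter> block_dominoes c))}) =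
      \<rho> * real (card {M \<in> matchings (aztec_squares (n - 1)). Q (compl (\<lambda>c\<in>C. \<Union>(M \<inter> block_dominoes c)))})" for Q
  proof -
    define K where "K = {\<kappa> \<in> PiE C coverages. exact_cover C \<kappa> (aztec_squares n) \<and> Q \<kappa>}"
    define K' where "K' = {\<kappa> \<in> PiE C coverages. exact_cover C \<kappa> (aztec_squares (n - 1)) \<and> Q (compl \<kappa>)}"
    have compl_in: "compl \<kappa> \<in> PiE C coverages" if "\<kappa> \<in> PiE C coverages" for \<kappa>
      using that coverages_compl(2) by (auto simp: compl_def)
    have compl_compl: "compl (compl \<kappa>) = \<kappa>" if "\<kappa> \<in> PiE C coverages" for \<kappa>
    proof
      fix c show "compl (compl \<kappa>) c = \<kappa> c"
        using PiE_arb[OF that, of c] coverages_compl(1)[OF PiE_mem[OF that], of c]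
        by (cases "c \<in> C") (simp_all add: compl_def double_diff)
    qed
    have exact: "exact_cover C (compl \<kappa>) (aztec_squares (n - 1)) \<longleftrightarrow> exact_cover C \<kappa> (aztec_squares n)"
      if "\<kappa> \<in> PiE C coverages" for \<kappa>
      using exact_cover_compl[OF assms, of \<kappa>] that by (simp add: C_def compl_def)
    have "(\<Sum>\<kappa>'\<in>K'. 2 ^ card {c \<in> C. \<kappa>' c = block c} :: real) = (\<Sum>\<kappa>\<in>K. 2 ^ card {c \<in> C. \<kappa> c = {}})"
    proof (rule sum.reindex_bij_witness[of _ compl compl])
      fix \<kappa> assume "\<kappa> \<in> K"
      then have \<kappa>: "\<kappa> \<in> PiE C coverages" and "exact_cover C \<kappa> (aztec_squares n)" "Q \<kappa>"
        by (auto simp: K_def)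
      then show "compl \<kappa> \<in> K'" "compl (compl \<kappa>) = \<kappa>"
        using compl_in exact compl_compl by (auto simp: K'_def)
    next
      fix \<kappa> assume "\<kappa> \<in> K'"
      then have \<kappa>: "\<kappa> \<in> PiE C coverages" and *: "exact_cover C \<kappa> (aztec_squares (n - 1))" "Q (compl \<kappa>)"
        by (auto simp: K'_def)
      then show "compl \<kappa> \<in> K" "compl (compl \<kappa>) = \<kappa>"
        using compl_in exact[of "compl \<kappa>"] compl_compl by (auto simp: K_def)
      have "\<kappa> c = block c \<longleftrightarrow> compl \<kappa> c = {}" if "c \<in> C" for c
        using \<kappa> that coverages_compl(1)[of "\<kappa> c" c] by (auto simp: compl_def PiE_iff)
      then have "{c \<in> C. compl \<kappa> c = {}} = {c \<in> C. \<kappa> c = block c}" by blast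
      then show "(2 ^ card {c \<in> C. compl \<kappa> c = {}} :: real) = 2 ^ card {c \<in> C. \<kappa> c = block c}" by simp
    qed
    moreover have "(2::real) ^ card {c \<in> C. \<kappa> c = block c} = \<rho> * 2 ^ card {c \<in> C. \<kappa> c = {}}" if "\<kappa> \<in> K" for \<kappa>
    proof -
      have "card (aztec_squares n) + 2 * card {c \<in> C. \<kappa> c = {}} = 2 * card C + 2 * card {c \<in> C. \<kappa> c = block c}"
        unfolding C_def using that by (intro exact_cover_excess finite_aztec_squares) (auto simp: K_def C_def)
      then have "h + card {c \<in> C. \<kappa> c = {}} = card C + card {c \<in> C. \<kappa> c = block c}"
        unfolding h_def by presburger
      then have "(2::real) ^ h * 2 ^ card {c \<in> C. \<kappa> c = {}} = 2 ^ card C * 2 ^ card {c \<in> C. \<kappa> c = block c}"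
        by (simp flip: power_add)
      then show ?thesis by (simp add: \<rho>_def field_simps)
    qed
    moreover have "card {M \<in> matchings (aztec_squares n). Q (\<lambda>c\<in>C. \<Union>(M \<inter> block_dominoes c))} =
        (\<Sum>\<kappa>\<in>K. 2 ^ card {c \<in> C. \<kappa> c = block c})"
      unfolding K_def C_def by (rule card_matchings_by_coverage) (rule aztec_domino_in_block)
    moreover have "card {M \<in> matchings (aztec_squares (n - 1)). Q (compl (\<lambda>c\<in>C. \<Union>(M \<inter> block_dominoes c)))} =
        (\<Sum>\<kappa>\<in>K'. 2 ^ card {c \<in> C. \<kappa> c = block c})"
      unfolding K'_def C_def
      by (rule card_matchings_by_coverage[where Q = "\<lambda>\<kappa>. Q (compl \<kappa>)"])
         (use aztec_domino_in_block aztec_squares_mono in blast)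
    ultimately show ?thesis
      by (simp add: sum_distrib_left)
  qed
  have "compl (\<lambda>c\<in>C. \<Union>(M \<inter> block_dominoes c)) = (\<lambda>c\<in>C. block c - \<Union>(M \<inter> block_dominoes c))" for M
    by (simp add: compl_def cong: restrict_cong)
  with main show thesis
    by (intro that[of \<rho>]) (simp_all add: \<rho>_def C_def)
qed

section \<open>Resampling one block\<close>

lemma domino_nonempty: "D \<in> dominoes \<Longrightarrow> D \<noteq> {}"
  by (auto simp: dominoes_def)

lemma finite_matchings: "finite A \<Longrightarrow> finite (matchings A)"
  by (rule finite_subset[of _ "Pow (Pow A)"]) (auto simp: matchings_def)

lemma exchange_in_matchings:
  assumes M: "M \<in> matchings A" "S \<subseteq> M" and T: "T \<subseteq> dominoes" "disjoint T" "\<Union>S = \<Union>T"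
  shows "M - S \<union> T \<in> matchings A" "(M - S) \<inter> T = {}"
proof -
  have M': "M \<subseteq> dominoes" "\<Union>M = A" "disjoint M" using M by (auto simp: matchings_def)
  have apart: "D \<inter> E = {}" if "D \<in> M - S" "E \<in> T" for D E
  proof -
    have "D \<inter> D' = {}" if "D' \<in> S" for D'
      using that \<open>D \<in> M - S\<close> M(2) by (intro disjointD[OF M'(3)]) auto
    then have "D \<inter> \<Union>S = {}" by blast
    then show ?thesis using T(3) that by blast
  qed
  have "disjoint (M - S \<union> T)"
  proof (rule disjointI)
    fix D E assume *: "D \<in> M - S \<union> T" "E \<in> M - S \<union> T" "D \<noteq> E"
    then consider "D \<in> M - S" "E \<in> M - S" | "D \<in> T" "E \<in> T" | "D \<in> M - S" "E \<in> T" | "D \<in> T" "E \<in> M - S"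
      by blast
    then show "D \<inter> E = {}"
    proof cases
      case 1
      then show ?thesis using *(3) by (intro disjointD[OF M'(3)]) auto
    next
      case 2
      then show ?thesis using *(3) by (intro disjointD[OF T(2)])
    next
      case 3
      then show ?thesis by (rule apart)
    next
      case 4
      then show ?thesis using apart[of E D] by blast
    qed
  qed
  moreover have "\<Union>(M - S \<union> T) = A"
  proof -
    have "\<Union>(M - S \<union> T) = \<Union>(M - S) \<union> \<Union>S" using T(3) by (simp add: Union_Un_distrib)
    also have "\<dots> = \<Union>M" using M(2) by blast
    finally show ?thesis using M'(2) by simp
  qed
  moreover have "M - S \<union> T \<subseteq> dominoes" using M'(1) T(1) by blast
  ultimately show "M - S \<union> T \<in> matchings A" by (simp add: matchings_def)
  show "(M - S) \<inter> T = {}"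
  proof (rule ccontr)
    assume "(M - S) \<inter> T \<noteq> {}"
    then obtain D where D: "D \<in> M - S" "D \<in> T" by blast
    then have "D = {}" using apart[of D D] by simp
    moreover have "D \<noteq> {}" using D(2) T(1) domino_nonempty by (metis subsetD)
    ultimately show False by simp
  qed
qed

text \<open>
  Replacing dominoes of a matching by others that cover the same squares is an invertible operation.
  With two parallel dominoes this is the rotation of a full block.
\<close>

lemma card_matchings_exchange:
  assumes "S \<subseteq> dominoes" "disjoint S" "T \<subseteq> dominoes" "disjoint T" "\<Union>S = \<Union>T"
  shows "card {M \<in> matchings A. S \<subseteq> M} = card {M \<in> matchings A. T \<subseteq> M}"
proof (rule bij_betw_same_card)
  have *: "M - S \<union> T - T \<union> S = M" if "M \<in> matchings A" "S \<subseteq> M"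
    "T \<subseteq> dominoes" "disjoint T" "\<Union>S = \<Union>T" for M S T
  proof -
    have "M - S \<union> T - T = M - S" using exchange_in_matchings(2)[OF that] by blast
    then show ?thesis using that(2) by (simp only: Un_Diff_cancel2 Un_absorb2)
  qed
  show "bij_betw (\<lambda>M. M - S \<union> T) {M \<in> matchings A. S \<subseteq> M} {M \<in> matchings A. T \<subseteq> M}"
  proof (rule bij_betw_byWitness[where f' = "\<lambda>M. M - T \<union> S"])
    show "\<forall>M\<in>{M \<in> matchings A. S \<subseteq> M}. M - S \<union> T - T \<union> S = M"
      using * assms by simp
    show "\<forall>M\<in>{M \<in> matchings A. T \<subseteq> M}. M - T \<union> S - S \<union> T = M"
      using * assms by simp
    have step: "(\<lambda>M. M - S \<union> T) ` {M \<in> matchings A. S \<subseteq> M} \<subseteq> {M \<in> matchings A. T \<subseteq> M}"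
      if "T \<subseteq> dominoes" "disjoint T" "\<Union>S = \<Union>T" for S T
    proof (rule image_subsetI)
      fix M assume "M \<in> {M \<in> matchings A. S \<subseteq> M}"
      then have "M - S \<union> T \<in> matchings A"
        using exchange_in_matchings(1)[OF _ _ that] by simp
      then show "M - S \<union> T \<in> {M \<in> matchings A. T \<subseteq> M}" by simp
    qed
    show "(\<lambda>M. M - S \<union> T) ` {M \<in> matchings A. S \<subseteq> M} \<subseteq> {M \<in> matchings A. T \<subseteq> M}"
      using assms(3-5) by (rule step)
    show "(\<lambda>M. M - T \<union> S) ` {M \<in> matchings A. T \<subseteq> M} \<subseteq> {M \<in> matchings A. S \<subseteq> M}"
      using assms(1,2) assms(5)[symmetric] by (rule step)
  qed
qed

lemma matching_block_state: "M \<in> matchings A \<Longrightarrow> M \<inter> block_dominoes c \<in> states c"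
  by (auto simp: matchings_def states_def disjoint_def)

lemma matching_block_coverage: "M \<in> matchings A \<Longrightarrow> \<Union>(M \<inter> block_dominoes c) \<in> coverages c"
  using matching_block_state[of M A c] Union_states[of c] by blast

definition coverage_card :: "(int \<times> int) set \<Rightarrow> int \<times> int \<Rightarrow> (int \<times> int) set \<Rightarrow> nat" where
  "coverage_card A c X = card {M \<in> matchings A. \<Union>(M \<inter> block_dominoes c) = X}"

text \<open>
  The domino occurs in its block either alone, which is visible in the coverage, or together with the
  parallel domino, which by rotation happens in half of the matchings where the block is full.
\<close>

lemma card_matchings_containing:
  assumes "finite A" "D \<in> block_dominoes c"
  shows "2 * card {M \<in> matchings A. D \<in> M} = 2 * coverage_card A c D + coverage_card A c (block c)"
proof -
  obtain x y where c: "c = (x, y)" by (cases c)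
  define h v where hv: "h = {hdom x y, hdom x (y - 1)}" "v = {vdom x y, vdom (x - 1) y}"
  note [simp] = block_neq block_neq[symmetric]
  have state: "M \<inter> block_dominoes c \<in> {{}, {hdom x y}, {hdom x (y - 1)}, {vdom x y}, {vdom (x - 1) y}, h, v}"
    if "M \<in> matchings A" for M
    using matching_block_state[OF that, of c] unfolding c states_eq hv .
  have E: "block_dominoes c = h \<union> v" by (simp add: c hv block_dominoes.simps insert_commute)
  have Uh: "\<Union>h = block c" and Uv: "\<Union>v = block c"
    unfolding hv c by (simp_all add: block_dominoes_union)
  have full: "\<Union>(M \<inter> block_dominoes c) = block c \<longleftrightarrow> h \<subseteq> M \<or> v \<subseteq> M" if M: "M \<in> matchings A" for M
  proof
    assume "\<Union>(M \<inter> block_dominoes c) = block c"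
    with state[OF M] have "M \<inter> block_dominoes c = h \<or> M \<inter> block_dominoes c = v"
      by (elim insertE emptyE) (simp_all add: c)
    then show "h \<subseteq> M \<or> v \<subseteq> M" by blast
  next
    assume "h \<subseteq> M \<or> v \<subseteq> M"
    then have "block c \<subseteq> \<Union>(M \<inter> block_dominoes c)" using Uh Uv E by blast
    moreover have "\<Union>(M \<inter> block_dominoes c) \<subseteq> block c"
      using Uh Uv E by blast
    ultimately show "\<Union>(M \<inter> block_dominoes c) = block c" by blast
  qed
  have not_both: "\<not> (h \<subseteq> M \<and> v \<subseteq> M)" if M: "M \<in> matchings A" for M
  proof
    assume "h \<subseteq> M \<and> v \<subseteq> M"
    then have "hdom x y \<in> M" "vdom x y \<in> M" by (simp_all add: hv)
    moreover have "disjoint M" using M by (simp add: matchings_def)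
    ultimately have "hdom x y \<inter> vdom x y = {}" by (intro disjointD[of M]) simp_all
    then show False using block_dominoes_overlap(3) by blast
  qed
  have fin: "finite (matchings A)" using assms(1) by (rule finite_matchings)
  have "coverage_card A c (block c) = card ({M \<in> matchings A. h \<subseteq> M} \<union> {M \<in> matchings A. v \<subseteq> M})"
    unfolding coverage_card_def by (rule arg_cong[of _ _ card]) (use full in blast)
  also have "\<dots> = card {M \<in> matchings A. h \<subseteq> M} + card {M \<in> matchings A. v \<subseteq> M}"
    using fin not_both by (intro card_Un_disjoint) auto
  finally have sum: "coverage_card A c (block c) = card {M \<in> matchings A. h \<subseteq> M} + card {M \<in> matchings A. v \<subseteq> M}" .
  have "card {M \<in> matchings A. h \<subseteq> M} = card {M \<in> matchings A. v \<subseteq> M}"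
  proof (rule card_matchings_exchange)
    show "disjoint h" "disjoint v"
      by (auto simp: hv disjoint_def block_dominoes_overlap(1,2) Int_commute)
    show "\<Union>h = \<Union>v" using Uh Uv by simp
  qed (simp_all add: hv)
  with sum have half: "2 * card {M \<in> matchings A. p \<subseteq> M} = coverage_card A c (block c)" if "p \<in> {h, v}" for p
    using that by auto
  have "(D = hdom x y \<or> D = hdom x (y - 1)) \<or> (D = vdom x y \<or> D = vdom (x - 1) y)"
    using assms(2) by (simp add: c block_dominoes.simps)
  then obtain p where p': "p = h \<and> (D = hdom x y \<or> D = hdom x (y - 1)) \<or> p = v \<and> (D = vdom x y \<or> D = vdom (x - 1) y)"
    by blast
  then have p: "p \<in> {h, v}" "D \<in> p" by (auto simp: hv)
  have mem: "D \<in> s \<longleftrightarrow> \<Union>s = D \<or> p \<subseteq> s"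
    if "s \<in> {{}, {hdom x y}, {hdom x (y - 1)}, {vdom x y}, {vdom (x - 1) y}, h, v}" for s
    using that p' unfolding hv
    by (elim insertE emptyE disjE conjE) (simp_all add: block_dominoes_union)
  have "D \<in> M \<longleftrightarrow> \<Union>(M \<inter> block_dominoes c) = D \<or> p \<subseteq> M" if M: "M \<in> matchings A" for M
  proof -
    have "D \<in> M \<longleftrightarrow> D \<in> M \<inter> block_dominoes c" "p \<subseteq> M \<longleftrightarrow> p \<subseteq> M \<inter> block_dominoes c"
      using assms(2) p E by auto
    then show ?thesis
      using mem[OF state[OF M]] by simp
  qed
  then have "{M \<in> matchings A. D \<in> M} =
      {M \<in> matchings A. \<Union>(M \<inter> block_dominoes c) = D} \<union> {M \<in> matchings A. p \<subseteq> M}"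
    by blast
  moreover have "{M \<in> matchings A. \<Union>(M \<inter> block_dominoes c) = D} \<inter> {M \<in> matchings A. p \<subseteq> M} = {}"
  proof -
    have "D \<noteq> block c" using assms(2) by (auto simp: c block_dominoes.simps)
    then show ?thesis using full p(1) by blast
  qed
  ultimately have "card {M \<in> matchings A. D \<in> M} = coverage_card A c D + card {M \<in> matchings A. p \<subseteq> M}"
    using fin by (simp add: card_Un_disjoint coverage_card_def)
  with half[OF p(1)] show ?thesis by simp
qed

lemma card_matchings_sum_coverage:
  assumes "finite A"
  shows "card (matchings A) = (\<Sum>X\<in>coverages c. coverage_card A c X)"
proof -
  have "matchings A = (\<Union>X\<in>coverages c. {M \<in> matchings A. \<Union>(M \<inter> block_dominoes c) = X})"
    using matching_block_coverage by blast
  then have "card (matchings A) = card (\<Union>X\<in>coverages c. {M \<in> matchings A. \<Union>(M \<inter> block_dominoes c) = X})"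
    by simp
  also have "\<dots> = (\<Sum>X\<in>coverages c. coverage_card A c X)"
    unfolding coverage_card_def using finite_matchings[OF assms]
    by (intro card_UN_disjoint) (auto simp: finite_coverages)
  finally show ?thesis .
qed

text \<open>
  Inclusion and exclusion over the four dominoes: a block with one domino is counted once in the sum
  and a full block twice.
\<close>

lemma coverage_card_empty_block:
  assumes "finite A"
  shows "coverage_card A c {} + (\<Sum>D\<in>block_dominoes c. card {M \<in> matchings A. D \<in> M}) =
    card (matchings A) + coverage_card A c (block c)"
proof -
  obtain x y where c: "c = (x, y)" by (cases c)
  have "(\<Sum>D\<in>block_dominoes c. 2 * card {M \<in> matchings A. D \<in> M}) =
    (\<Sum>D\<in>block_dominoes c. 2 * coverage_card A c D + coverage_card A c (block c))"
    by (intro sum.cong refl card_matchings_containing assms)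
  also have "\<dots> = 2 * (\<Sum>D\<in>block_dominoes c. coverage_card A c D) + 4 * coverage_card A c (block c)"
    by (simp add: sum.distrib sum_distrib_left[symmetric] c block_dominoes.simps)
  finally have "(\<Sum>D\<in>block_dominoes c. card {M \<in> matchings A. D \<in> M}) =
    (\<Sum>D\<in>block_dominoes c. coverage_card A c D) + 2 * coverage_card A c (block c)"
    by (simp add: sum_distrib_left[symmetric])
  moreover have "card (matchings A) = coverage_card A c {} + coverage_card A c (block c) + (\<Sum>D\<in>block_dominoes c. coverage_card A c D)"
    unfolding card_matchings_sum_coverage[OF assms, of c] coverages_def c block_dominoes.simps
    by (simp add: block_neq block_neq[symmetric])
  ultimately show ?thesis by simp
qed

lemma aztec_squares_0: "aztec_squares 0 = {}"
proof -
  have False if "(i, j) \<in> aztec_squares 0" for i j :: int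
  proof -
    have "\<bar>i\<bar> + \<bar>i + 1\<bar> \<ge> 1" by linarith
    with that show False by (simp add: aztec_squares_alt)
  qed
  then show ?thesis by auto
qed

lemma matchings_empty: "matchings {} = {{}}"
  using domino_nonempty by (auto simp: matchings_def)

lemma card_matchings_aztec_pos: "card (matchings (aztec_squares n)) > 0"
proof (induction n)
  case 0
  then show ?case by (simp add: aztec_squares_0 matchings_empty)
next
  case (Suc n)
  obtain \<rho> :: real where \<rho>: "\<rho> > 0" and eq: "\<And>Q. real (card {M \<in> matchings (aztec_squares (Suc n)). Q (\<lambda>c\<in>cells (Suc n). \<Union>(M \<inter> block_dominoes c))}) =
      \<rho> * real (card {M \<in> matchings (aztec_squares (Suc n - 1)). Q (\<lambda>c\<in>cells (Suc n). block c - \<Union>(M \<inter> block_dominoes c))})"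
    using card_matchings_shuffle[of "Suc n"] by auto
  from eq[of "\<lambda>_. True"] Suc \<rho> have "real (card (matchings (aztec_squares (Suc n)))) > 0" by simp
  then show ?case by (simp only: of_nat_0_less_iff)
qed

definition domino_prob :: "nat \<Rightarrow> (int \<times> int) set \<Rightarrow> real" where
  "domino_prob n D = card {M \<in> matchings (aztec_squares n). D \<in> M} / card (matchings (aztec_squares n))"

lemma coverage_card_shuffle:
  assumes "n \<ge> 1" "c \<in> cells n" "X \<in> coverages c"
  shows "coverage_card (aztec_squares n) c X / card (matchings (aztec_squares n)) =
    coverage_card (aztec_squares (n - 1)) c (block c - X) / card (matchings (aztec_squares (n - 1)))"
proof -
  obtain \<rho> :: real where \<rho>: "\<rho> > 0" and eq: "\<And>Q. real (card {M \<in> matchings (aztec_squares n). Q (\<lambda>c\<in>cells n. \<Union>(M \<inter> block_dominoes c))}) =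
      \<rho> * real (card {M \<in> matchings (aztec_squares (n - 1)). Q (\<lambda>c\<in>cells n. block c - \<Union>(M \<inter> block_dominoes c))})"
    using card_matchings_shuffle[OF assms(1)] by blast
  have "{M \<in> matchings (aztec_squares (n - 1)). block c - \<Union>(M \<inter> block_dominoes c) = X} =
    {M \<in> matchings (aztec_squares (n - 1)). \<Union>(M \<inter> block_dominoes c) = block c - X}"
    using coverages_compl(1)[OF assms(3)] coverages_compl(1)[OF matching_block_coverage] by blast
  then have "real (coverage_card (aztec_squares n) c X) = \<rho> * real (coverage_card (aztec_squares (n - 1)) c (block c - X))"
    using eq[of "\<lambda>\<kappa>. \<kappa> c = X"] assms(2) by (simp add: coverage_card_def)
  moreover have "real (card (matchings (aztec_squares n))) = \<rho> * real (card (matchings (aztec_squares (n - 1))))"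
    using eq[of "\<lambda>_. True"] by simp
  ultimately show ?thesis using \<rho> by simp
qed

lemma block_diff:
  "block (x, y) - hdom x y = hdom x (y - 1)" "block (x, y) - hdom x (y - 1) = hdom x y"
  "block (x, y) - vdom x y = vdom (x - 1) y" "block (x, y) - vdom (x - 1) y = vdom x y"
  by (simp_all add: hdom_def vdom_def block.simps insert_Diff_if insert_commute)

text \<open>
  The domino \<open>D\<close> occurs alone in its block with the probability with which, one size earlier, the
  opposite domino does, and together with its parallel with half the probability that the block is
  empty one size earlier.  In terms of domino probabilities, the two contributions of full blocks
  cancel.
\<close>

lemma domino_prob_shuffle:
  assumes "n \<ge> 1" "c \<in> cells n" "D \<in> block_dominoes c"
  shows "domino_prob n D = domino_prob (n - 1) (block c - D)
    + (1 - (\<Sum>D\<in>block_dominoes c. domino_prob (n - 1) D)) / 2"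
proof -
  define N N' where NN': "N = real (card (matchings (aztec_squares n)))" "N' = real (card (matchings (aztec_squares (n - 1))))"
  have pos: "N > 0" "N' > 0" unfolding NN' using card_matchings_aztec_pos by simp_all
  define a a' where aa': "a X = real (coverage_card (aztec_squares n) c X)"
    "a' X = real (coverage_card (aztec_squares (n - 1)) c X)" for X
  have D: "D \<in> coverages c" "block c \<in> coverages c" using assms(3) by (simp_all add: coverages_def)
  have D': "block c - D \<in> block_dominoes c"
  proof -
    obtain x y where c: "c = (x, y)" by (cases c)
    show ?thesis
      using assms(3) unfolding c block_dominoes.simps
      by (elim insertE emptyE) (simp_all add: block_diff)
  qed
  have shift: "a D / N = a' (block c - D) / N'" "a (block c) / N = a' {} / N'"
    using coverage_card_shuffle[OF assms(1,2)] D by (simp_all add: aa' NN')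
  have "2 * domino_prob n D * N = 2 * a D + a (block c)"
    using card_matchings_containing[OF finite_aztec_squares assms(3), of n, THEN arg_cong[of _ _ real]] pos
    by (simp add: domino_prob_def aa' NN')
  then have 1: "2 * domino_prob n D = 2 * (a D / N) + a (block c) / N"
    using pos by (simp add: field_simps)
  have "2 * domino_prob (n - 1) (block c - D) * N' = 2 * a' (block c - D) + a' (block c)"
    using card_matchings_containing[OF finite_aztec_squares D', of "n - 1", THEN arg_cong[of _ _ real]] pos
    by (simp add: domino_prob_def aa' NN')
  then have 2: "2 * domino_prob (n - 1) (block c - D) = 2 * (a' (block c - D) / N') + a' (block c) / N'"
    using pos by (simp add: field_simps)
  have "a' {} + (\<Sum>D\<in>block_dominoes c. domino_prob (n - 1) D) * N' = N' + a' (block c)"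
    using coverage_card_empty_block[OF finite_aztec_squares, of "n - 1" c, THEN arg_cong[of _ _ real]] pos
    by (simp add: domino_prob_def aa' NN' sum_divide_distrib[symmetric])
  then have 3: "a' {} / N' + (\<Sum>D\<in>block_dominoes c. domino_prob (n - 1) D) = 1 + a' (block c) / N'"
    using pos by (simp add: field_simps)
  show ?thesis using 1 2 3 shift by (simp add: field_simps)
qed

section \<open>Placement probabilities and the wave equation\<close>

definition hprob :: "nat \<Rightarrow> int \<Rightarrow> int \<Rightarrow> real" where
  "hprob n x y = domino_prob n (hdom x y)"

definition vprob :: "nat \<Rightarrow> int \<Rightarrow> int \<Rightarrow> real" where
  "vprob n x y = domino_prob n (vdom x y)"

lemma domino_prob_outside:
  assumes "\<not> D \<subseteq> aztec_squares n"
  shows "domino_prob n D = 0"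
proof -
  have "{M \<in> matchings (aztec_squares n). D \<in> M} = {}"
    using assms by (auto simp: matchings_def)
  then show ?thesis unfolding domino_prob_def by (simp only: card.empty of_nat_0 div_0)
qed

lemma hprob_0 [simp]: "hprob 0 x y = 0" and vprob_0 [simp]: "vprob 0 x y = 0"
  by (simp_all add: hprob_def vprob_def domino_prob_outside aztec_squares_0 hdom_def vdom_def)

text \<open>
  Exactly one of the four dominoes that contain a given square of the diamond belongs to a tiling.
\<close>

lemma sum_prob_at_square:
  "hprob n x y + hprob n (x + 1) y + vprob n x y + vprob n x (y + 1) = of_bool ((x, y) \<in> aztec_squares n)"
proof (cases "(x, y) \<in> aztec_squares n")
  case False
  then show ?thesis
    by (simp add: hprob_def vprob_def domino_prob_outside hdom_def vdom_def)
next
  case True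
  define Ds where "Ds = {hdom x y, hdom (x + 1) y, vdom x y, vdom x (y + 1)}"
  let ?A = "aztec_squares n"
  have in_Ds: "D \<in> Ds" if "D \<in> dominoes" "(x, y) \<in> D" for D
  proof (cases rule: dominoes_cases[OF that(1)])
    case (1 a b)
    with that(2) have "a = x + 1 \<and> b = y \<or> a = x \<and> b = y"
      unfolding hdom_def by simp linarith
    with 1 show ?thesis by (elim disjE) (simp_all add: Ds_def)
  next
    case (2 a b)
    with that(2) have "a = x \<and> b = y + 1 \<or> a = x \<and> b = y"
      unfolding vdom_def by simp linarith
    with 2 show ?thesis by (elim disjE) (simp_all add: Ds_def)
  qed
  have Ds: "(x, y) \<in> D" if "D \<in> Ds" for D
    using that unfolding Ds_def by (elim insertE emptyE) (simp_all add: hdom_def vdom_def)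
  have "matchings ?A = (\<Union>D\<in>Ds. {M \<in> matchings ?A. D \<in> M})"
  proof (intro equalityI subsetI)
    fix M assume M: "M \<in> matchings ?A"
    then obtain D where "D \<in> M" "(x, y) \<in> D" using True by (auto simp: matchings_def)
    moreover from this M have "D \<in> dominoes" by (auto simp: matchings_def)
    ultimately show "M \<in> (\<Union>D\<in>Ds. {M \<in> matchings ?A. D \<in> M})" using M in_Ds by blast
  qed blast
  then have "card (matchings ?A) = card (\<Union>D\<in>Ds. {M \<in> matchings ?A. D \<in> M})" by simp
  also have "\<dots> = (\<Sum>D\<in>Ds. card {M \<in> matchings ?A. D \<in> M})"
  proof (intro card_UN_disjoint ballI impI)
    fix D E assume DE: "D \<in> Ds" "E \<in> Ds" "D \<noteq> E"
    have False if "M \<in> matchings ?A" "D \<in> M" "E \<in> M" for M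
    proof -
      have "disjoint M" using that by (simp add: matchings_def)
      then have "D \<inter> E = {}" using that DE(3) by (intro disjointD)
      then show False using Ds DE by blast
    qed
    then show "{M \<in> matchings ?A. D \<in> M} \<inter> {M \<in> matchings ?A. E \<in> M} = {}" by blast
  qed (auto simp: Ds_def finite_matchings finite_aztec_squares)
  also have "\<dots> = card {M \<in> matchings ?A. hdom x y \<in> M} + card {M \<in> matchings ?A. hdom (x + 1) y \<in> M}
    + card {M \<in> matchings ?A. vdom x y \<in> M} + card {M \<in> matchings ?A. vdom x (y + 1) \<in> M}"
    by (simp add: Ds_def)
  finally have "real (card {M \<in> matchings ?A. hdom x y \<in> M}) + real (card {M \<in> matchings ?A. hdom (x + 1) y \<in> M})
    + real (card {M \<in> matchings ?A. vdom x y \<in> M}) + real (card {M \<in> matchings ?A. vdom x (y + 1) \<in> M})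
    = real (card (matchings ?A))"
    by simp
  then show ?thesis
    using True card_matchings_aztec_pos[of n]
    by (simp add: hprob_def vprob_def domino_prob_def add_divide_distrib[symmetric])
qed

text \<open>
  For \<open>x + y + n\<close> odd this is the indicator of the cells of size \<open>n\<close>.
\<close>

definition cell_indicator :: "nat \<Rightarrow> int \<Rightarrow> int \<Rightarrow> real" where
  "cell_indicator n x y = of_bool (\<bar>x\<bar> + \<bar>y\<bar> < int n)"

text \<open>
  For a cell this is the probability that the block is empty minus the probability that it is full, one
  size earlier.
\<close>

definition creation :: "nat \<Rightarrow> int \<Rightarrow> int \<Rightarrow> real" where
  "creation n x y = cell_indicator n x y -
     (hprob (n - 1) x y + hprob (n - 1) x (y - 1) + vprob (n - 1) x y + vprob (n - 1) (x - 1) y)"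

text \<open>
  The shuffling identity also holds at lattice points of the right parity that are not cells: there all
  terms vanish, because the dominoes of the block lie in neither diamond.  This removes all boundary cases
  from the linear recurrences that follow.
\<close>

lemma prob_shuffle:
  assumes "odd (x + y + int (Suc n))"
  shows "hprob (Suc n) x y = hprob n x (y - 1) + creation (Suc n) x y / 2"
    and "hprob (Suc n) x (y - 1) = hprob n x y + creation (Suc n) x y / 2"
    and "vprob (Suc n) x y = vprob n (x - 1) y + creation (Suc n) x y / 2"
    and "vprob (Suc n) (x - 1) y = vprob n x y + creation (Suc n) x y / 2"
proof -
  have "hprob (Suc n) x y = hprob n x (y - 1) + creation (Suc n) x y / 2 \<and>
    hprob (Suc n) x (y - 1) = hprob n x y + creation (Suc n) x y / 2 \<and>
    vprob (Suc n) x y = vprob n (x - 1) y + creation (Suc n) x y / 2 \<and>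
    vprob (Suc n) (x - 1) y = vprob n x y + creation (Suc n) x y / 2"
  proof (cases "\<bar>x\<bar> + \<bar>y\<bar> < int (Suc n)")
    case True
    with assms have c: "(x, y) \<in> cells (Suc n)" by (simp add: cells_def)
    have "(\<Sum>D\<in>block_dominoes (x, y). domino_prob n D) = hprob n x y + hprob n x (y - 1) + vprob n x y + vprob n (x - 1) y"
      by (simp add: block_dominoes.simps hprob_def vprob_def)
    then have *: "domino_prob (Suc n) D = domino_prob n (block (x, y) - D) + creation (Suc n) x y / 2"
      if "D \<in> block_dominoes (x, y)" for D
      using domino_prob_shuffle[OF _ c that] True by (simp add: creation_def cell_indicator_def)
    show ?thesis
      using *[of "hdom x y"] *[of "hdom x (y - 1)"] *[of "vdom x y"] *[of "vdom (x - 1) y"]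
      by (simp add: hprob_def vprob_def block_diff block_dominoes.simps)
  next
    case False
    have outside: "\<not> D \<subseteq> aztec_squares (Suc n)" if "D \<in> block_dominoes (x, y)" for D
    proof
      assume "D \<subseteq> aztec_squares (Suc n)"
      then obtain c where c: "c \<in> cells (Suc n)" "D \<in> block_dominoes c"
        using aztec_domino_in_block block_dominoes_subset \<open>D \<in> block_dominoes (x, y)\<close> by blast
      obtain x' y' where "c = (x', y')" by (cases c)
      with c have "(x, y) = (x', y')" "\<bar>x'\<bar> + \<bar>y'\<bar> < int (Suc n)"
        using block_dominoes_same_parity[OF assms _ that, of x' y'] by (simp_all add: cells_def)
      with False show False by simp
    qed
    have zero: "domino_prob (Suc n) D = 0" "domino_prob n D = 0" if "D \<in> block_dominoes (x, y)" for D
      using outside[OF that] aztec_squares_mono[of "Suc n"]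
      by (auto intro!: domino_prob_outside)
    have D: "hdom x y \<in> block_dominoes (x, y)" "hdom x (y - 1) \<in> block_dominoes (x, y)"
      "vdom x y \<in> block_dominoes (x, y)" "vdom (x - 1) y \<in> block_dominoes (x, y)"
      by (simp_all add: block_dominoes.simps)
    show ?thesis
      using D[THEN zero(1)] D[THEN zero(2)] False
      by (simp add: creation_def cell_indicator_def hprob_def vprob_def)
  qed
  then show "hprob (Suc n) x y = hprob n x (y - 1) + creation (Suc n) x y / 2"
    "hprob (Suc n) x (y - 1) = hprob n x y + creation (Suc n) x y / 2"
    "vprob (Suc n) x y = vprob n (x - 1) y + creation (Suc n) x y / 2"
    "vprob (Suc n) (x - 1) y = vprob n x y + creation (Suc n) x y / 2"
    by blast+
qed

text \<open>
  This cancels the inhomogeneous terms of the recurrence for the creation rates.  Points well inside give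
  \<open>1 - 1 + 4 = 4\<close>, and points outside give \<open>0 = 0\<close>.  On the boundary, where \<open>\<bar>x\<bar> + \<bar>y\<bar> = n\<close>, the sum is
  \<open>1 + 1 = 2\<close> at a corner and \<open>1 + 2 = 3\<close> elsewhere.
\<close>

lemma cell_square_balance:
  fixes x y :: int
  assumes n: "n \<ge> 1" and parity: "even (x + y + int n)"
  shows "cell_indicator (Suc n) x y - cell_indicator (n - 1) x y + (cell_indicator n (x + 1) y + cell_indicator n (x - 1) y + cell_indicator n x (y + 1) + cell_indicator n x (y - 1))
    = of_bool ((x, y) \<in> aztec_squares n) + of_bool ((x - 1, y) \<in> aztec_squares n)
    + of_bool ((x, y - 1) \<in> aztec_squares n) + of_bool ((x - 1, y - 1) \<in> aztec_squares n)"
proof -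
  have sq: "(x, y) \<in> aztec_squares n \<longleftrightarrow> \<bar>x + 1\<bar> + \<bar>y\<bar> < int n \<or> \<bar>x\<bar> + \<bar>y + 1\<bar> < int n"
    "(x - 1, y - 1) \<in> aztec_squares n \<longleftrightarrow> \<bar>x\<bar> + \<bar>y - 1\<bar> < int n \<or> \<bar>x - 1\<bar> + \<bar>y\<bar> < int n"
    "(x, y - 1) \<in> aztec_squares n \<longleftrightarrow> \<bar>x\<bar> + \<bar>y - 1\<bar> < int n \<or> \<bar>x + 1\<bar> + \<bar>y\<bar> < int n"
    "(x - 1, y) \<in> aztec_squares n \<longleftrightarrow> \<bar>x - 1\<bar> + \<bar>y\<bar> < int n \<or> \<bar>x\<bar> + \<bar>y + 1\<bar> < int n"
  proof -
    have "even (x - 1 + (y - 1) + int n)" "odd (x + (y - 1) + int n)" "odd (x - 1 + y + int n)"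
      using parity by presburger+
    then show "(x, y) \<in> aztec_squares n \<longleftrightarrow> \<bar>x + 1\<bar> + \<bar>y\<bar> < int n \<or> \<bar>x\<bar> + \<bar>y + 1\<bar> < int n"
      "(x - 1, y - 1) \<in> aztec_squares n \<longleftrightarrow> \<bar>x\<bar> + \<bar>y - 1\<bar> < int n \<or> \<bar>x - 1\<bar> + \<bar>y\<bar> < int n"
      "(x, y - 1) \<in> aztec_squares n \<longleftrightarrow> \<bar>x\<bar> + \<bar>y - 1\<bar> < int n \<or> \<bar>x + 1\<bar> + \<bar>y\<bar> < int n"
      "(x - 1, y) \<in> aztec_squares n \<longleftrightarrow> \<bar>x - 1\<bar> + \<bar>y\<bar> < int n \<or> \<bar>x\<bar> + \<bar>y + 1\<bar> < int n"
      using antidiagonal_cells_square(1)[OF n, of x y] antidiagonal_cells_square(1)[OF n, of "x - 1" "y - 1"]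
        diagonal_cells_square(1)[OF n, of x "y - 1"] diagonal_cells_square(1)[OF n, of "x - 1" y] parity
      by (simp_all only: diff_add_cancel simp_thms disj_commute)
  qed
  have n1: "int (n - 1) = int n - 1" "int (Suc n) = int n + 1" using n by simp_all
  have "even (\<bar>x\<bar> + \<bar>y\<bar> + int n)" using parity by presburger
  then have "\<bar>x\<bar> + \<bar>y\<bar> + 1 \<noteq> int n" "\<bar>x\<bar> + \<bar>y\<bar> \<noteq> int n + 1" by presburger+
  then consider "\<bar>x\<bar> + \<bar>y\<bar> + 2 \<le> int n" | "\<bar>x\<bar> + \<bar>y\<bar> = int n" | "\<bar>x\<bar> + \<bar>y\<bar> \<ge> int n + 2"
    by linarith
  then show ?thesis
  proof cases
    case 1
    then have "\<bar>x + 1\<bar> + \<bar>y\<bar> < int n" "\<bar>x - 1\<bar> + \<bar>y\<bar> < int n" "\<bar>x\<bar> + \<bar>y + 1\<bar> < int n" "\<bar>x\<bar> + \<bar>y - 1\<bar> < int n"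
      by linarith+
    then show ?thesis unfolding cell_indicator_def sq n1 using 1 by simp
  next
    case 3
    then have "\<not> \<bar>x + 1\<bar> + \<bar>y\<bar> < int n" "\<not> \<bar>x - 1\<bar> + \<bar>y\<bar> < int n" "\<not> \<bar>x\<bar> + \<bar>y + 1\<bar> < int n" "\<not> \<bar>x\<bar> + \<bar>y - 1\<bar> < int n"
      by linarith+
    then show ?thesis unfolding cell_indicator_def sq n1 using 3 by simp
  next
    case 2
    have "\<bar>x + 1\<bar> + \<bar>y\<bar> < int n \<longleftrightarrow> x < 0" "\<bar>x - 1\<bar> + \<bar>y\<bar> < int n \<longleftrightarrow> x > 0"
      "\<bar>x\<bar> + \<bar>y + 1\<bar> < int n \<longleftrightarrow> y < 0" "\<bar>x\<bar> + \<bar>y - 1\<bar> < int n \<longleftrightarrow> y > 0"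
      unfolding 2[symmetric] by linarith+
    moreover have "x \<noteq> 0 \<or> y \<noteq> 0" using 2 n by auto
    ultimately show ?thesis
      unfolding cell_indicator_def sq n1 using 2 by (auto simp: of_bool_def)
  qed
qed

lemma sum_prob_at_block:
  assumes "odd (x + y + int n)"
  shows "hprob n x y + hprob n x (y - 1) + vprob n x y + vprob n (x - 1) y =
    cell_indicator n x y + (if n = 0 then 0 else creation n x y)"
proof (cases n)
  case 0
  then show ?thesis by (simp add: cell_indicator_def)
next
  case (Suc k)
  then show ?thesis
    using prob_shuffle[of x y k] assms by (simp add: creation_def[of "Suc k"])
qed

text \<open>
  The solution of the discrete wave equation whose only initial value is an impulse at the origin at
  time 1.
\<close>

fun wave :: "nat \<Rightarrow> int \<Rightarrow> int \<Rightarrow> real" where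
  "wave 0 x y = 0"
| "wave (Suc 0) x y = of_bool (x = 0 \<and> y = 0)"
| "wave (Suc (Suc n)) x y =
     (wave (Suc n) (x + 1) y + wave (Suc n) (x - 1) y + wave (Suc n) x (y + 1) + wave (Suc n) x (y - 1)) / 2 - wave n x y"

text \<open>
  Add the equations \<open>sum_prob_at_square\<close> for the four squares of the block.  The dominoes inside the
  block appear twice and give, by definition, the creation rate at time \<open>n + 2\<close>.  The eight dominoes that stick out
  of the block belong to the four neighbouring blocks, where their sum is known up to the two other
  dominoes of the same block.  One of these two lies inside the central block.  The other one is moved
  by shuffling from the side of the central block one step earlier, and the four such terms
  add up to the creation rate at time \<open>n\<close>, up to the indicator of the cell.
\<close>

lemma creation_wave_equation:
  assumes "even (x + y + int (Suc n))"
  shows "creation (Suc (Suc n)) x y =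
    (creation (Suc n) (x + 1) y + creation (Suc n) (x - 1) y + creation (Suc n) x (y + 1) + creation (Suc n) x (y - 1)) / 2
    - (if n = 0 then 0 else creation n x y)"
proof -
  have e: "odd (x + 1 + y + int (Suc n))" and w: "odd (x - 1 + y + int (Suc n))"
    and nn: "odd (x + (y + 1) + int (Suc n))" and s: "odd (x + (y - 1) + int (Suc n))" and c: "odd (x + y + int n)"
    using assms by presburger+
  define prev where "prev = (if n = 0 then 0 else creation n x y)"
  define inner where "inner = hprob (Suc n) x y + hprob (Suc n) x (y - 1) + vprob (Suc n) x y + vprob (Suc n) (x - 1) y"
  have norm: "a + 1 - 1 = a" "a - 1 + 1 = a" for a :: int by simp_all
  have east: "hprob (Suc n) (x + 1) y + hprob (Suc n) (x + 1) (y - 1)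
      = cell_indicator (Suc n) (x + 1) y + creation (Suc n) (x + 1) y / 2 - vprob (Suc n) x y - vprob n x y"
    using sum_prob_at_block[OF e] prob_shuffle(3)[OF e] unfolding norm by simp
  have west: "hprob (Suc n) (x - 1) y + hprob (Suc n) (x - 1) (y - 1)
      = cell_indicator (Suc n) (x - 1) y + creation (Suc n) (x - 1) y / 2 - vprob (Suc n) (x - 1) y - vprob n (x - 1) y"
    using sum_prob_at_block[OF w] prob_shuffle(4)[OF w] unfolding norm by simp
  have north: "vprob (Suc n) x (y + 1) + vprob (Suc n) (x - 1) (y + 1)
      = cell_indicator (Suc n) x (y + 1) + creation (Suc n) x (y + 1) / 2 - hprob (Suc n) x y - hprob n x y"
    using sum_prob_at_block[OF nn] prob_shuffle(1)[OF nn] unfolding norm by simp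
  have south: "vprob (Suc n) x (y - 1) + vprob (Suc n) (x - 1) (y - 1)
      = cell_indicator (Suc n) x (y - 1) + creation (Suc n) x (y - 1) / 2 - hprob (Suc n) x (y - 1) - hprob n x (y - 1)"
    using sum_prob_at_block[OF s] prob_shuffle(2)[OF s] unfolding norm by simp
  have "2 * inner + (hprob (Suc n) (x + 1) y + hprob (Suc n) (x + 1) (y - 1))
      + (hprob (Suc n) (x - 1) y + hprob (Suc n) (x - 1) (y - 1))
      + (vprob (Suc n) x (y + 1) + vprob (Suc n) (x - 1) (y + 1))
      + (vprob (Suc n) x (y - 1) + vprob (Suc n) (x - 1) (y - 1))
    = of_bool ((x, y) \<in> aztec_squares (Suc n)) + of_bool ((x - 1, y) \<in> aztec_squares (Suc n))
      + of_bool ((x, y - 1) \<in> aztec_squares (Suc n)) + of_bool ((x - 1, y - 1) \<in> aztec_squares (Suc n))"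
    unfolding sum_prob_at_square[symmetric] inner_def norm by simp
  also have "\<dots> = cell_indicator (Suc (Suc n)) x y - cell_indicator n x y
      + (cell_indicator (Suc n) (x + 1) y + cell_indicator (Suc n) (x - 1) y + cell_indicator (Suc n) x (y + 1) + cell_indicator (Suc n) x (y - 1))"
    using cell_square_balance[OF _ assms] by simp
  finally have "inner = cell_indicator (Suc (Suc n)) x y - cell_indicator n x y
      - (creation (Suc n) (x + 1) y + creation (Suc n) (x - 1) y + creation (Suc n) x (y + 1) + creation (Suc n) x (y - 1)) / 2
      + (hprob n x y + hprob n x (y - 1) + vprob n x y + vprob n (x - 1) y)"
    unfolding east west north south inner_def by (simp add: field_simps)
  moreover have "creation (Suc (Suc n)) x y = cell_indicator (Suc (Suc n)) x y - inner"
    by (simp add: creation_def[of "Suc (Suc n)"] inner_def)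
  ultimately show ?thesis
    unfolding sum_prob_at_block[OF c] prev_def[symmetric] by simp
qed

lemma creation_eq_wave:
  "odd (x + y + int (Suc n)) \<Longrightarrow> creation (Suc n) x y = wave (Suc n) x y"
proof (induction n arbitrary: x y rule: less_induct)
  case (less n)
  show ?case
  proof (cases n)
    case 0
    have "\<bar>x\<bar> + \<bar>y\<bar> < 1 \<longleftrightarrow> x = 0 \<and> y = 0" by linarith
    then show ?thesis by (simp add: 0 creation_def cell_indicator_def)
  next
    case (Suc k)
    have par: "even (x + y + int (Suc k))" using less.prems by (simp add: Suc)
    have *: "creation (Suc k) a b = wave (Suc k) a b"
      if "(a, b) \<in> {(x + 1, y), (x - 1, y), (x, y + 1), (x, y - 1)}" for a b
    proof (rule less.IH)
      show "k < n" by (simp add: Suc)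
      show "odd (a + b + int (Suc k))" using that par by auto
    qed
    have "(if k = 0 then 0 else creation k x y) = wave k x y"
    proof (cases k)
      case (Suc j)
      with less.IH[of j x y] par show ?thesis by (simp add: \<open>n = Suc k\<close>)
    qed simp
    then show ?thesis
      unfolding Suc creation_wave_equation[OF par] wave.simps by (simp add: *)
  qed
qed

lemma wave_swap: "wave n y x = wave n x y"
  by (induction n x y rule: wave.induct) (auto simp: algebra_simps)

lemma wave_reflect: "wave n x (- y) = wave n x y"
proof (induction n x y rule: wave.induct)
  case (3 n x y)
  have "- y + 1 = - (y - 1)" "- y - 1 = - (y + 1)" by simp_all
  then show ?case using 3 by (simp only: wave.simps) simp
qed auto

lemma hprob_wave:
  assumes "odd (x + y + int (Suc n))"
  shows "hprob (Suc n) x y = hprob n x (y - 1) + wave (Suc n) x y / 2"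
  using prob_shuffle(1)[OF assms] creation_eq_wave[OF assms] by simp

text \<open>
  The four types of dominoes satisfy recurrences that are carried into each other by the symmetries of
  the wave, so it suffices to know the probabilities of the upper dominoes of blocks.
\<close>

lemma prob_symmetries:
  "odd (x + y + int n) \<Longrightarrow>
    hprob n x (y - 1) = hprob n x (- y) \<and> vprob n x y = hprob n y x \<and> vprob n (x - 1) y = hprob n y (- x)"
proof (induction n arbitrary: x y)
  case (Suc n)
  have odds: "odd (x + (y + 1) + int n)" "odd (x - 1 + y + int n)" "odd (x + 1 + y + int n)"
    "odd (x + - y + int (Suc n))" "odd (y + x + int (Suc n))" "odd (y + - x + int (Suc n))"
    using Suc.prems by presburger+
  note sh = prob_shuffle[OF Suc.prems, unfolded creation_eq_wave[OF Suc.prems]]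
  have w: "wave (Suc n) x (- y) = wave (Suc n) x y" "wave (Suc n) y x = wave (Suc n) x y"
    "wave (Suc n) y (- x) = wave (Suc n) x y"
    using wave_reflect wave_swap by metis+
  show ?case
    using Suc.IH[OF odds(1)] Suc.IH[OF odds(2)] Suc.IH[OF odds(3)] sh
      hprob_wave[OF odds(4)] hprob_wave[OF odds(5)] hprob_wave[OF odds(6)]
    by (simp add: w)
qed simp

lemma hprob_sum_reflections:
  assumes "odd (x + y + int (Suc n))"
  shows "hprob (Suc n) x y + hprob (Suc n) x (- y) + hprob (Suc n) y x + hprob (Suc n) y (- x)
    = cell_indicator (Suc n) x y + wave (Suc n) x y"
  using sum_prob_at_block[OF assms] prob_symmetries[OF assms] creation_eq_wave[OF assms] by simp

section \<open>The wave as a product of Krawtchouk values\<close>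

text \<open>
  The value \<open>kraw k a b\<close> is the Krawtchouk number, the coefficient of \<open>z ^ a\<close> in
  \<open>(1 + z) ^ (k - b) * (1 - z) ^ b\<close>, extended by 0 outside \<open>0 \<le> a \<le> k\<close>, \<open>0 \<le> b \<le> k\<close>.  The
  recursion multiplies by \<open>1 + z\<close>, or by \<open>1 - z\<close> when \<open>b\<close> is maximal.
\<close>

fun kraw :: "nat \<Rightarrow> int \<Rightarrow> int \<Rightarrow> real" where
  "kraw 0 a b = of_bool (a = 0 \<and> b = 0)"
| "kraw (Suc k) a b =
     (if 0 \<le> b \<and> b \<le> int k then kraw k a b + kraw k (a - 1) b
      else if b = int k + 1 then kraw k a (b - 1) - kraw k (a - 1) (b - 1) else 0)"

lemma kraw_outside: "\<not> (0 \<le> a \<and> a \<le> int k \<and> 0 \<le> b \<and> b \<le> int k) \<Longrightarrow> kraw k a b = 0"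
  by (induction k arbitrary: a b) auto

lemma kraw_Suc: "0 \<le> b \<Longrightarrow> b \<le> int k \<Longrightarrow> kraw (Suc k) a b = kraw k a b + kraw k (a - 1) b"
  by simp

text \<open>
  Multiplication by \<open>1 - z\<close> is possible in every column, because the factors commute.
\<close>

lemma kraw_Suc_Suc: "0 \<le> b \<Longrightarrow> b \<le> int k \<Longrightarrow> kraw (Suc k) a (b + 1) = kraw k a b - kraw k (a - 1) b"
proof (induction k arbitrary: a b)
  case (Suc k)
  show ?case
  proof (cases "b = int (Suc k)")
    case False
    with Suc.prems have b: "0 \<le> b" "b \<le> int k" by simp_all
    have "kraw (Suc (Suc k)) a (b + 1) = kraw (Suc k) a (b + 1) + kraw (Suc k) (a - 1) (b + 1)"
      using b by (intro kraw_Suc) auto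
    then show ?thesis
      unfolding Suc.IH[OF b] kraw_Suc[OF b] by simp
  qed (simp del: kraw.simps(2) add: kraw.simps(2)[of "Suc k"])
qed simp

lemma kraw_0: "0 \<le> b \<Longrightarrow> b \<le> int k \<Longrightarrow> kraw k 0 b = 1"
proof (induction k arbitrary: b)
  case (Suc k)
  show ?case
  proof (cases "b = int k + 1")
    case True
    then show ?thesis using Suc.IH[of "int k"] by (simp add: kraw_outside)
  next
    case False
    then show ?thesis using Suc.IH[of b] Suc.prems by (simp add: kraw_outside)
  qed
qed simp

lemma kraw_top: "b \<le> k \<Longrightarrow> kraw k (int k) (int b) = (- 1) ^ b"
proof (induction k arbitrary: b)
  case (Suc k)
  show ?case
  proof (cases "b = Suc k")
    case True
    then show ?thesis using Suc.IH[of k] by (simp add: kraw_outside)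
  next
    case False
    then show ?thesis using Suc.IH[of b] Suc.prems by (simp add: kraw_outside)
  qed
qed simp

declare kraw.simps(2) [simp del]

definition kraw2 :: "nat \<Rightarrow> int \<Rightarrow> int \<Rightarrow> real" where
  "kraw2 k a b = kraw k a b * kraw k b a"

lemma kraw2_outside: "\<not> (0 \<le> a \<and> a \<le> int k \<and> 0 \<le> b \<and> b \<le> int k) \<Longrightarrow> kraw2 k a b = 0"
  by (simp add: kraw2_def kraw_outside)

lemma kraw2_swap: "kraw2 k b a = kraw2 k a b"
  by (simp add: kraw2_def)

text \<open>
  Writing \<open>X\<close> and \<open>Y\<close> for the values of the two factors at the four points \<open>(a, b)\<close>,
  \<open>(a - 1, b)\<close>, \<open>(a, b - 1)\<close>, \<open>(a - 1, b - 1)\<close>, the two recursions give one linear relation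
  between the four values \<open>X\<close> and one between the four values \<open>Y\<close>, and express the values at the
  neighbouring levels as linear forms.  The claim is then a polynomial identity.
\<close>

lemma kraw2_step_interior:
  assumes "1 \<le> a" "a \<le> int k + 1" "1 \<le> b" "b \<le> int k + 1"
  shows "kraw2 (Suc (Suc k)) a b + 4 * kraw2 k (a - 1) (b - 1) =
    kraw2 (Suc k) a b + kraw2 (Suc k) (a - 1) (b - 1) + kraw2 (Suc k) a (b - 1) + kraw2 (Suc k) (a - 1) b"
proof -
  have rec: "kraw (Suc (Suc k)) a b = kraw (Suc k) a b + kraw (Suc k) (a - 1) b"
    "kraw (Suc k) a (b - 1) = kraw (Suc k) a b + kraw (Suc k) (a - 1) b + kraw (Suc k) (a - 1) (b - 1)"
    "2 * kraw k (a - 1) (b - 1) = kraw (Suc k) a (b - 1) - kraw (Suc k) a b"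
    if "1 \<le> a" "a \<le> int k + 1" "1 \<le> b" "b \<le> int k + 1" for a b
  proof -
    show 1: "kraw (Suc (Suc k)) a b = kraw (Suc k) a b + kraw (Suc k) (a - 1) b"
      using that by (intro kraw_Suc) auto
    show "kraw (Suc k) a (b - 1) = kraw (Suc k) a b + kraw (Suc k) (a - 1) b + kraw (Suc k) (a - 1) (b - 1)"
      using kraw_Suc_Suc[of "b - 1" "Suc k" a] 1 that by simp
    show "2 * kraw k (a - 1) (b - 1) = kraw (Suc k) a (b - 1) - kraw (Suc k) a b"
      using kraw_Suc_Suc[of "b - 1" k a] kraw_Suc[of "b - 1" k a] that by simp
  qed
  note ab = rec[OF assms] and ba = rec[OF assms(3,4,1,2)]
  have "4 * kraw2 k (a - 1) (b - 1) = (2 * kraw k (a - 1) (b - 1)) * (2 * kraw k (b - 1) (a - 1))"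
    by (simp add: kraw2_def)
  then show ?thesis
    unfolding ab(3) ba(3) kraw2_def ab(1,2) ba(1,2) by (simp add: algebra_simps)
qed

text \<open>
  On the boundary one of the factors is \<open>1\<close> or \<open>(- 1) ^ a\<close>, and the step reduces to one of the
  linear recursions.
\<close>

lemma kraw2_boundary:
  assumes "b = 0 \<or> b = int k + 1"
  shows "kraw2 (Suc k) a b =
    kraw2 k a b + kraw2 k (a - 1) (b - 1) + kraw2 k a (b - 1) + kraw2 k (a - 1) b"
proof (cases "0 \<le> a \<and> a \<le> int k + 1")
  case False
  then show ?thesis by (auto simp: kraw2_outside)
next
  case a: True
  from assms show ?thesis
  proof
    assume b: "b = 0"
    have one: "kraw (Suc k) 0 a = 1" using a by (intro kraw_0) auto
    have absorb: "kraw k c 0 * kraw k 0 c = kraw k c 0" for c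
      by (cases "0 \<le> c \<and> c \<le> int k") (auto simp: kraw_0 kraw_outside)
    have "kraw k c (0 - 1) = 0" for c by (simp add: kraw_outside)
    then show ?thesis
      unfolding b kraw2_def one absorb by (simp add: kraw_Suc)
  next
    assume b: "b = int k + 1"
    have top: "kraw (Suc k) (int k + 1) a = (- 1) ^ nat a"
    proof -
      have "nat a \<le> Suc k" using a by linarith
      then show ?thesis using kraw_top[of "nat a" "Suc k"] a by (simp add: add.commute)
    qed
    have *: "kraw k c (int k) * kraw k (int k) c = kraw k c (int k) * (- 1) ^ nat c" if "0 \<le> c" for c
      using kraw_top[of "nat c" k] that by (cases "c \<le> int k") (auto simp: kraw_outside nat_le_iff)
    have "kraw k (a - 1) (int k) * kraw k (int k) (a - 1) = - (kraw k (a - 1) (int k) * (- 1) ^ nat a)"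
    proof (cases "a = 0")
      case False
      then have "nat a = Suc (nat (a - 1))" using a by linarith
      then show ?thesis using *[of "a - 1"] False a by simp
    qed (simp add: kraw_outside)
    then have "kraw2 k (a - 1) (b - 1) = - (kraw k (a - 1) (int k) * (- 1) ^ nat a)"
      "kraw2 k a (b - 1) = kraw k a (int k) * (- 1) ^ nat a"
      using *[of a] a by (simp_all add: kraw2_def b)
    moreover have "kraw2 k a b = 0" "kraw2 k (a - 1) b = 0"
      using b by (simp_all add: kraw2_outside)
    moreover have "kraw2 (Suc k) a b = (kraw k a (int k) - kraw k (a - 1) (int k)) * (- 1) ^ nat a"
      unfolding kraw2_def b top using kraw_Suc_Suc[of "int k" k a] by simp
    ultimately show ?thesis by (simp add: left_diff_distrib)
  qed
qed

lemma kraw2_step: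
  "kraw2 (Suc (Suc k)) a b + 4 * kraw2 k (a - 1) (b - 1) =
    kraw2 (Suc k) a b + kraw2 (Suc k) (a - 1) (b - 1) + kraw2 (Suc k) a (b - 1) + kraw2 (Suc k) (a - 1) b"
proof -
  consider "1 \<le> a" "a \<le> int k + 1" "1 \<le> b" "b \<le> int k + 1"
    | "\<not> (0 \<le> a \<and> a \<le> int (Suc (Suc k)) \<and> 0 \<le> b \<and> b \<le> int (Suc (Suc k)))"
    | "b = 0 \<or> b = int (Suc k) + 1" | "a = 0 \<or> a = int (Suc k) + 1"
    by fastforce
  then show ?thesis
  proof cases
    case 1
    then show ?thesis by (rule kraw2_step_interior)
  next
    case 2
    then show ?thesis by (subst (1 2 3 4 5 6) kraw2_outside) auto
  next
    case 3
    then have "kraw2 k (a - 1) (b - 1) = 0" by (intro kraw2_outside) auto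
    then show ?thesis using kraw2_boundary[OF 3, of a] by simp
  next
    case 4
    then have "kraw2 k (a - 1) (b - 1) = 0" by (intro kraw2_outside) auto
    then show ?thesis using kraw2_boundary[OF 4, of b] by (simp add: kraw2_swap[of _ a] kraw2_swap[of _ "a - 1"])
  qed
qed

text \<open>
  In the coordinates \<open>x = a + b - k\<close>, \<open>y = a - b\<close> the four neighbours of \<open>(x, y)\<close> at the previous
  time have indices \<open>a\<close> or \<open>a - 1\<close> and \<open>b\<close> or \<open>b - 1\<close>, so the wave equation becomes
  \<open>kraw2_step\<close>.
\<close>

lemma wave_eq_kraw2: "wave (Suc k) (a + b - int k) (a - b) = kraw2 k a b / 2 ^ k"
proof (induction k arbitrary: a b rule: less_induct)
  case (less k)
  show ?case
  proof (cases k)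
    case 0
    have "a + b = 0 \<and> a = b \<longleftrightarrow> a = 0 \<and> b = 0" by auto
    then show ?thesis by (auto simp: 0 kraw2_def)
  next
    case (Suc j)
    define x y where xy: "x = a + b - int k" "y = a - b"
    have nbrs: "wave (Suc j) (x + 1) y = kraw2 j a b / 2 ^ j"
      "wave (Suc j) (x - 1) y = kraw2 j (a - 1) (b - 1) / 2 ^ j"
      "wave (Suc j) x (y + 1) = kraw2 j a (b - 1) / 2 ^ j"
      "wave (Suc j) x (y - 1) = kraw2 j (a - 1) b / 2 ^ j"
      using less.IH[of j a b] less.IH[of j "a - 1" "b - 1"] less.IH[of j a "b - 1"] less.IH[of j "a - 1" b]
      by (simp_all add: Suc xy algebra_simps)
    have "wave (Suc (Suc j)) x y = kraw2 (Suc j) a b / 2 ^ Suc j"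
    proof (cases j)
      case 0
      have "kraw2 1 a b = kraw2 0 a b + kraw2 0 (a - 1) (b - 1) + kraw2 0 a (b - 1) + kraw2 0 (a - 1) b"
      proof (cases "b = 0 \<or> b = 1")
        case True
        then show ?thesis using kraw2_boundary[of b 0 a] by simp
      next
        case False
        then show ?thesis by (simp add: kraw2_outside)
      qed
      then show ?thesis using nbrs by (simp add: 0)
    next
      case (Suc i)
      have "wave j x y = kraw2 i (a - 1) (b - 1) / 2 ^ i"
        using less.IH[of i "a - 1" "b - 1"] by (simp add: \<open>k = Suc j\<close> Suc xy algebra_simps)
      then have "wave (Suc (Suc j)) x y = (kraw2 (Suc i) a b + kraw2 (Suc i) (a - 1) (b - 1) + kraw2 (Suc i) a (b - 1) + kraw2 (Suc i) (a - 1) b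
          - 4 * kraw2 i (a - 1) (b - 1)) / 2 ^ Suc j"
        unfolding wave.simps nbrs by (simp add: Suc field_simps)
      then show ?thesis unfolding kraw2_step[of i a b, symmetric] by (simp add: Suc)
    qed
    then show ?thesis by (simp add: xy Suc)
  qed
qed

lemma wave_parity: "even (x + y + int n) \<Longrightarrow> wave n x y = 0"
proof (induction n x y rule: wave.induct)
  case (3 n x y)
  have "even (x + 1 + y + int (Suc n))" "even (x - 1 + y + int (Suc n))"
    "even (x + (y + 1) + int (Suc n))" "even (x + (y - 1) + int (Suc n))" "even (x + y + int n)"
    using 3(6) by presburger+
  then show ?case using 3(1-5) by simp
qed auto

section \<open>Rational multiples of a weight on residue classes\<close>

text \<open>
  The set
  \<open>D\<close> is part of the definition because the closed form has to be free of poles at every size for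
  which the domino fits into the diamond.
\<close>

definition rational_on :: "nat set \<Rightarrow> (nat \<Rightarrow> real) \<Rightarrow> bool" where
  "rational_on D f \<longleftrightarrow> (\<exists>num den :: real poly. den \<noteq> 0 \<and>
     (\<forall>p\<in>D. poly den (real p) \<noteq> 0 \<and> f p = poly num (real p) / poly den (real p)))"

lemma rational_on_mono: "rational_on D f \<Longrightarrow> D' \<subseteq> D \<Longrightarrow> rational_on D' f"
  unfolding rational_on_def by blast

lemma rational_on_poly: "rational_on D (\<lambda>p. poly q (real p))"
  unfolding rational_on_def by (intro exI[of _ q] exI[of _ 1]) simp

lemma rational_on_const: "rational_on D (\<lambda>_. c)"
  using rational_on_poly[of D "[:c:]"] by simp

lemma rational_on_linear: "rational_on D (\<lambda>p. a * real p + b)"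
  using rational_on_poly[of D "[:b, a:]"] by (simp add: algebra_simps)

lemma rational_on_add:
  assumes "rational_on D f" "rational_on D g"
  shows "rational_on D (\<lambda>p. f p + g p)"
proof -
  obtain a b where 1: "b \<noteq> 0" "\<forall>p\<in>D. poly b (real p) \<noteq> 0 \<and> f p = poly a (real p) / poly b (real p)"
    using assms(1) unfolding rational_on_def by blast
  obtain c d where 2: "d \<noteq> 0" "\<forall>p\<in>D. poly d (real p) \<noteq> 0 \<and> g p = poly c (real p) / poly d (real p)"
    using assms(2) unfolding rational_on_def by blast
  show ?thesis
    unfolding rational_on_def using 1 2
    by (intro exI[of _ "a * d + c * b"] exI[of _ "b * d"]) (simp add: add_frac_eq)
qed

lemma rational_on_mult:
  assumes "rational_on D f" "rational_on D g"
  shows "rational_on D (\<lambda>p. f p * g p)"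
proof -
  obtain a b where 1: "b \<noteq> 0" "\<forall>p\<in>D. poly b (real p) \<noteq> 0 \<and> f p = poly a (real p) / poly b (real p)"
    using assms(1) unfolding rational_on_def by blast
  obtain c d where 2: "d \<noteq> 0" "\<forall>p\<in>D. poly d (real p) \<noteq> 0 \<and> g p = poly c (real p) / poly d (real p)"
    using assms(2) unfolding rational_on_def by blast
  show ?thesis
    unfolding rational_on_def using 1 2
    by (intro exI[of _ "a * c"] exI[of _ "b * d"]) simp
qed

lemma rational_on_inverse:
  assumes "rational_on D f" "\<And>p. p \<in> D \<Longrightarrow> f p \<noteq> 0"
  shows "rational_on D (\<lambda>p. inverse (f p))"
proof (cases "D = {}")
  case True
  then show ?thesis unfolding rational_on_def by (intro exI[of _ 1]) simp
next
  case False
  then obtain q where q: "q \<in> D" by blast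
  obtain a b where 1: "b \<noteq> 0" "\<forall>p\<in>D. poly b (real p) \<noteq> 0 \<and> f p = poly a (real p) / poly b (real p)"
    using assms(1) unfolding rational_on_def by blast
  have nz: "poly a (real p) \<noteq> 0" if "p \<in> D" for p using 1 assms(2)[OF that] that by auto
  then have "a \<noteq> 0" using q by fastforce
  then show ?thesis
    unfolding rational_on_def using 1 nz by (intro exI[of _ b] exI[of _ a]) simp
qed

lemma rational_on_divide:
  assumes "rational_on D f" "rational_on D g" "\<And>p. p \<in> D \<Longrightarrow> g p \<noteq> 0"
  shows "rational_on D (\<lambda>p. f p / g p)"
  using rational_on_mult[OF assms(1) rational_on_inverse[OF assms(2,3)]] by (simp add: divide_inverse)

lemma rational_on_compose_shift:
  assumes "rational_on D f" "\<And>p. p \<in> D' \<Longrightarrow> \<sigma> p \<in> D \<and> real (\<sigma> p) = real p + c"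
  shows "rational_on D' (\<lambda>p. f (\<sigma> p))"
proof -
  obtain a b where 1: "b \<noteq> 0" "\<forall>p\<in>D. poly b (real p) \<noteq> 0 \<and> f p = poly a (real p) / poly b (real p)"
    using assms(1) unfolding rational_on_def by blast
  have "b \<circ>\<^sub>p [:c, 1:] \<noteq> 0"
    using 1(1) by (subst pcompose_eq_0_iff) auto
  moreover have "poly (q \<circ>\<^sub>p [:c, 1:]) (real p) = poly q (real (\<sigma> p))" if "p \<in> D'" for q p
    using assms(2)[OF that] by (simp add: poly_pcompose add.commute)
  ultimately have "b \<circ>\<^sub>p [:c, 1:] \<noteq> 0 \<and> (\<forall>p\<in>D'. poly (b \<circ>\<^sub>p [:c, 1:]) (real p) \<noteq> 0 \<and>
      f (\<sigma> p) = poly (a \<circ>\<^sub>p [:c, 1:]) (real p) / poly (b \<circ>\<^sub>p [:c, 1:]) (real p))"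
    using 1(2) assms(2)[THEN conjunct1] by simp
  then show ?thesis unfolding rational_on_def by blast
qed

text \<open>
  The modulus 4 comes from the middle Krawtchouk column: with \<open>k = 2 q\<close> its entries are 0 or binomial
  coefficients of \<open>q\<close>, depending on the parities of \<open>k\<close> and of \<open>q\<close>.
\<close>

definition rational_multiple :: "(nat \<Rightarrow> real) \<Rightarrow> (nat \<Rightarrow> real) \<Rightarrow> nat \<Rightarrow> bool" where
  "rational_multiple w a n0 \<longleftrightarrow> (\<forall>\<alpha><4. \<exists>f. rational_on {p. n0 \<le> 4 * p + \<alpha>} f \<and>
     (\<forall>p. n0 \<le> 4 * p + \<alpha> \<longrightarrow> a (4 * p + \<alpha>) = w p * f p))"

lemma rational_multipleI:
  assumes "\<And>\<alpha>. \<alpha> < 4 \<Longrightarrow> \<exists>f. rational_on {p. n0 \<le> 4 * p + \<alpha>} f \<and> (\<forall>p. n0 \<le> 4 * p + \<alpha> \<longrightarrow> a (4 * p + \<alpha>) = w p * f p)"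
  shows "rational_multiple w a n0"
  using assms by (simp add: rational_multiple_def)

lemma rational_multipleE:
  assumes "rational_multiple w a n0" "\<alpha> < 4"
  obtains f where "rational_on {p. n0 \<le> 4 * p + \<alpha>} f" "\<And>p. n0 \<le> 4 * p + \<alpha> \<Longrightarrow> a (4 * p + \<alpha>) = w p * f p"
  using assms unfolding rational_multiple_def by blast

lemma rational_multiple_cong:
  assumes "rational_multiple w a n0" "\<And>n. n1 \<le> n \<Longrightarrow> b n = a n" "n0 \<le> n1"
  shows "rational_multiple w b n1"
proof (rule rational_multipleI)
  fix \<alpha> :: nat assume \<alpha>: "\<alpha> < 4"
  obtain f where f: "rational_on {p. n0 \<le> 4 * p + \<alpha>} f" "\<And>p. n0 \<le> 4 * p + \<alpha> \<Longrightarrow> a (4 * p + \<alpha>) = w p * f p"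
    using rational_multipleE[OF assms(1) \<alpha>] by blast
  have "rational_on {p. n1 \<le> 4 * p + \<alpha>} f"
    using assms(3) by (intro rational_on_mono[OF f(1)]) auto
  then show "\<exists>f. rational_on {p. n1 \<le> 4 * p + \<alpha>} f \<and> (\<forall>p. n1 \<le> 4 * p + \<alpha> \<longrightarrow> b (4 * p + \<alpha>) = w p * f p)"
    using f(2) assms(2,3) by (intro exI[of _ f]) auto
qed

lemma rational_multiple_linear:
  assumes "rational_multiple w a n0" "rational_multiple w b n0"
  shows "rational_multiple w (\<lambda>n. x * a n + y * b n) n0"
proof (rule rational_multipleI)
  fix \<alpha> :: nat assume \<alpha>: "\<alpha> < 4"
  let ?D = "{p. n0 \<le> 4 * p + \<alpha>}"
  obtain f where f: "rational_on ?D f" "\<And>p. n0 \<le> 4 * p + \<alpha> \<Longrightarrow> a (4 * p + \<alpha>) = w p * f p"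
    using rational_multipleE[OF assms(1) \<alpha>] by blast
  obtain g where g: "rational_on ?D g" "\<And>p. n0 \<le> 4 * p + \<alpha> \<Longrightarrow> b (4 * p + \<alpha>) = w p * g p"
    using rational_multipleE[OF assms(2) \<alpha>] by blast
  have "rational_on ?D (\<lambda>p. x * f p + y * g p)"
    by (intro rational_on_add rational_on_mult rational_on_const f(1) g(1))
  then show "\<exists>f. rational_on ?D f \<and> (\<forall>p. n0 \<le> 4 * p + \<alpha> \<longrightarrow> x * a (4 * p + \<alpha>) + y * b (4 * p + \<alpha>) = w p * f p)"
    using f(2) g(2) by (intro exI[of _ "\<lambda>p. x * f p + y * g p"]) (simp add: algebra_simps)
qed

lemma rational_multiple_mult:
  assumes "rational_multiple v a n0" "rational_multiple w b n0"
  shows "rational_multiple (\<lambda>p. v p * w p) (\<lambda>n. a n * b n) n0"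
proof (rule rational_multipleI)
  fix \<alpha> :: nat assume \<alpha>: "\<alpha> < 4"
  let ?D = "{p. n0 \<le> 4 * p + \<alpha>}"
  obtain f where f: "rational_on ?D f" "\<And>p. n0 \<le> 4 * p + \<alpha> \<Longrightarrow> a (4 * p + \<alpha>) = v p * f p"
    using rational_multipleE[OF assms(1) \<alpha>] by blast
  obtain g where g: "rational_on ?D g" "\<And>p. n0 \<le> 4 * p + \<alpha> \<Longrightarrow> b (4 * p + \<alpha>) = w p * g p"
    using rational_multipleE[OF assms(2) \<alpha>] by blast
  show "\<exists>f. rational_on ?D f \<and> (\<forall>p. n0 \<le> 4 * p + \<alpha> \<longrightarrow> a (4 * p + \<alpha>) * b (4 * p + \<alpha>) = v p * w p * f p)"
    using f g by (intro exI[of _ "\<lambda>p. f p * g p"]) (simp add: rational_on_mult)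
qed

lemma rational_multiple_half_power: "rational_multiple (\<lambda>p. (1 / 16) ^ p) (\<lambda>n. (1 / 2) ^ n) n0"
proof (rule rational_multipleI)
  fix \<alpha> :: nat
  have "(1 / 2 :: real) ^ (4 * p + \<alpha>) = (1 / 16) ^ p * (1 / 2) ^ \<alpha>" for p
    by (simp add: power_add power_mult power_one_over)
  then show "\<exists>f. rational_on {p. n0 \<le> 4 * p + \<alpha>} f \<and> (\<forall>p. n0 \<le> 4 * p + \<alpha> \<longrightarrow> (1 / 2 :: real) ^ (4 * p + \<alpha>) = (1 / 16) ^ p * f p)"
    by (intro exI[of _ "\<lambda>_. (1 / 2) ^ \<alpha>"]) (simp add: rational_on_const)
qed

lemma less_4_cases: "\<alpha> < 4 \<Longrightarrow> \<alpha> = 0 \<or> \<alpha> = 1 \<or> \<alpha> = 2 \<or> \<alpha> = (3::nat)"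
  by linarith

text \<open>
  A shift by one step permutes the residue classes; only the step from class 3 to class 0 changes \<open>p\<close>,
  and there the weight changes by a rational factor.
\<close>

lemma rational_multiple_Suc:
  assumes a: "rational_multiple w a n0" and w: "\<And>p. w (Suc p) = w p * r p" and r: "rational_on UNIV r"
  shows "rational_multiple w (\<lambda>n. a (Suc n)) (n0 - 1)"
proof (rule rational_multipleI)
  fix \<alpha> :: nat assume \<alpha>: "\<alpha> < 4"
  let ?D = "{p. n0 - 1 \<le> 4 * p + \<alpha>}"
  show "\<exists>f. rational_on ?D f \<and> (\<forall>p. n0 - 1 \<le> 4 * p + \<alpha> \<longrightarrow> a (Suc (4 * p + \<alpha>)) = w p * f p)"
  proof (cases "\<alpha> = 3")
    case False
    then obtain f where f: "rational_on {p. n0 \<le> 4 * p + Suc \<alpha>} f"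
      "\<And>p. n0 \<le> 4 * p + Suc \<alpha> \<Longrightarrow> a (4 * p + Suc \<alpha>) = w p * f p"
      using rational_multipleE[OF a, of "Suc \<alpha>"] \<alpha> by auto
    moreover have "?D = {p. n0 \<le> 4 * p + Suc \<alpha>}" by auto
    ultimately show ?thesis by (intro exI[of _ f]) auto
  next
    case True
    obtain f where f: "rational_on {p. n0 \<le> 4 * p + 0} f" "\<And>p. n0 \<le> 4 * p + 0 \<Longrightarrow> a (4 * p + 0) = w p * f p"
      using rational_multipleE[OF a, of 0] by auto
    have "rational_on ?D (\<lambda>p. f (Suc p))"
      using True by (intro rational_on_compose_shift[OF f(1), of _ _ 1]) auto
    then have "rational_on ?D (\<lambda>p. r p * f (Suc p))"
      using rational_on_mono[OF r] by (intro rational_on_mult) auto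
    moreover have "a (Suc (4 * p + \<alpha>)) = w p * (r p * f (Suc p))" if "n0 - 1 \<le> 4 * p + \<alpha>" for p
    proof -
      have "Suc (4 * p + \<alpha>) = 4 * Suc p + 0" using True by simp
      moreover have "n0 \<le> 4 * Suc p + 0" using that True by simp
      ultimately show ?thesis using f(2)[of "Suc p"] w by simp
    qed
    ultimately show ?thesis by blast
  qed
qed

text \<open>
  In contrast to the forward shift this needs the ratio \<open>r\<close> of the weights to be free of zeros.
\<close>

lemma rational_multiple_pred:
  assumes a: "rational_multiple w a n0" and w: "\<And>p. w (Suc p) = w p * r p" and r: "rational_on UNIV r" "\<And>p. r p \<noteq> 0"
  shows "rational_multiple w (\<lambda>n. a (n - 1)) (Suc n0)"
proof (rule rational_multipleI)
  fix \<alpha> :: nat assume \<alpha>: "\<alpha> < 4"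
  let ?D = "{p. Suc n0 \<le> 4 * p + \<alpha>}"
  show "\<exists>f. rational_on ?D f \<and> (\<forall>p. Suc n0 \<le> 4 * p + \<alpha> \<longrightarrow> a (4 * p + \<alpha> - 1) = w p * f p)"
  proof (cases \<alpha>)
    case (Suc \<beta>)
    then obtain f where f: "rational_on {p. n0 \<le> 4 * p + \<beta>} f" "\<And>p. n0 \<le> 4 * p + \<beta> \<Longrightarrow> a (4 * p + \<beta>) = w p * f p"
      using rational_multipleE[OF a, of \<beta>] \<alpha> by auto
    moreover have "?D = {p. n0 \<le> 4 * p + \<beta>}" by (auto simp: Suc)
    ultimately show ?thesis by (intro exI[of _ f]) (auto simp: Suc)
  next
    case 0
    obtain f where f: "rational_on {p. n0 \<le> 4 * p + 3} f" "\<And>p. n0 \<le> 4 * p + 3 \<Longrightarrow> a (4 * p + 3) = w p * f p"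
      using rational_multipleE[OF a, of 3] by auto
    have "rational_on ?D (\<lambda>p. f (p - 1))" "rational_on ?D (\<lambda>p. r (p - 1))"
      using 0 by (intro rational_on_compose_shift[OF f(1), of _ _ "- 1"] rational_on_compose_shift[OF r(1), of _ _ "- 1"]; auto)+
    then have "rational_on ?D (\<lambda>p. f (p - 1) / r (p - 1))"
      using r(2) by (intro rational_on_divide) auto
    moreover have "a (4 * p + \<alpha> - 1) = w p * (f (p - 1) / r (p - 1))" if p: "Suc n0 \<le> 4 * p + \<alpha>" for p
    proof -
      obtain q where q: "p = Suc q" using p 0 by (cases p) simp_all
      have e: "4 * p + \<alpha> - 1 = 4 * q + 3" "n0 \<le> 4 * q + 3" using p 0 q by auto
      show ?thesis unfolding e(1) f(2)[OF e(2)] using w[of q] r(2)[of q] by (simp add: q)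
    qed
    ultimately show ?thesis by blast
  qed
qed

section \<open>Values of the wave at a fixed position\<close>

text \<open>
  Binomial coefficients with an integer lower index, so that sums like \<open>p + j\<close> with negative \<open>j\<close>
  need no case distinction.
\<close>

definition int_choose :: "nat \<Rightarrow> int \<Rightarrow> real" where
  "int_choose n m = (if m < 0 then 0 else real (n choose nat m))"

lemma int_choose_Suc: "int_choose (Suc n) m = int_choose n m + int_choose n (m - 1)"
proof (cases "m \<le> 0")
  case True
  then show ?thesis by (cases "m = 0") (simp_all add: int_choose_def)
next
  case False
  define j where "j = nat (m - 1)"
  with False have m: "m = int (Suc j)" by simp
  have "nat (int (Suc j)) = Suc j" "nat (int (Suc j) - 1) = j" "\<not> int (Suc j) < 0" "\<not> int (Suc j) - 1 < 0"
    by linarith+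
  then show ?thesis unfolding m int_choose_def by (simp del: of_nat_Suc)
qed

definition int_sign :: "int \<Rightarrow> real" where
  "int_sign m = (if even m then 1 else - 1)"

lemma int_sign_add: "int_sign (int p + j) = (- 1) ^ p * int_sign j"
  by (simp add: int_sign_def minus_one_power_iff)

text \<open>
  In the middle column the generating function is \<open>(1 + z) ^ q * (1 - z) ^ q = (1 - z\<^sup>2) ^ q\<close>.
\<close>

lemma kraw_middle:
  "kraw (2 * q) a (int q) = (if even a then int_sign (a div 2) * int_choose q (a div 2) else 0)"
proof (induction q arbitrary: a)
  case 0
  show ?case
  proof (cases "a = 0")
    case False
    have "int_choose 0 (a div 2) = 0" if "even a"
      using that False by (auto simp: int_choose_def elim!: evenE)
    then show ?thesis using False by simp
  qed (simp add: int_sign_def int_choose_def)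
next
  case (Suc q)
  have "kraw (2 * Suc q) a (int (Suc q)) = kraw (Suc (2 * q)) a (int q + 1) + kraw (Suc (2 * q)) (a - 1) (int q + 1)"
    using kraw_Suc[of "int q + 1" "Suc (2 * q)" a] by (simp add: add.commute)
  also have "\<dots> = kraw (2 * q) a (int q) - kraw (2 * q) (a - 2) (int q)"
    using kraw_Suc_Suc[of "int q" "2 * q" a] kraw_Suc_Suc[of "int q" "2 * q" "a - 1"] by simp
  also have "\<dots> = (if even a then int_sign (a div 2) * int_choose (Suc q) (a div 2) else 0)"
  proof (cases "even a")
    case True
    then have "(a - 2) div 2 = a div 2 - 1" by presburger
    with True show ?thesis unfolding Suc.IH by (simp add: int_choose_Suc int_sign_def algebra_simps)
  qed (simp add: Suc.IH)
  finally show ?case .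
qed

text \<open>
  With the value \<open>1/2\<close> at \<open>p = 0\<close> this also holds for the first step, since \<open>binom 1 1 = 1\<close>.
\<close>

lemma binom_2p_minus_1_Suc:
  "binom_2p_minus_1 (Suc p) = binom_2p_minus_1 p * (2 * (2 * real p + 1) / (real p + 1))"
proof -
  have sym: "(2 * p + 1) choose p = (2 * p + 1) choose Suc p"
    using binomial_symmetric[of p "2 * p + 1"] by simp
  \<comment> \<open>both steps of the passage from \<open>binom (2 p) p\<close> to \<open>binom (2 p + 2) (p + 1)\<close> are absorption identities\<close>
  have 1: "(2 * p + 2) * ((2 * p + 1) choose p) = ((2 * p + 2) choose Suc p) * Suc p"
    using Suc_times_binomial_eq[of "2 * p + 1" p] by simp
  have 2: "(2 * p + 1) * ((2 * p) choose p) = ((2 * p + 1) choose Suc p) * Suc p"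
    using Suc_times_binomial_eq[of "2 * p" p] by simp
  have eq1: "(2 * real p + 2) * real ((2 * p + 1) choose Suc p) = real ((2 * p + 2) choose Suc p) * (real p + 1)"
    using arg_cong[OF 1, of real] unfolding sym of_nat_mult by (simp add: algebra_simps)
  have eq2: "(2 * real p + 1) * real ((2 * p) choose p) = real ((2 * p + 1) choose Suc p) * (real p + 1)"
    using arg_cong[OF 2, of real] unfolding of_nat_mult by (simp add: algebra_simps)
  have "real ((2 * p + 2) choose Suc p) = 2 * real ((2 * p + 1) choose Suc p)"
  proof -
    have "real ((2 * p + 2) choose Suc p) * (real p + 1) = 2 * real ((2 * p + 1) choose Suc p) * (real p + 1)"
      unfolding eq1[symmetric] by (simp add: algebra_simps)
    then show ?thesis by simp
  qed
  also have "real ((2 * p + 1) choose Suc p) = (2 * real p + 1) * real ((2 * p) choose p) / (real p + 1)"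
    using eq2 by (simp only: eq_divide_eq) simp
  finally have "real ((2 * Suc p) choose Suc p) = 2 * ((2 * real p + 1) * real ((2 * p) choose p) / (real p + 1))"
    by simp
  moreover have "2 * (a * c / b) / 2 = c / 2 * (2 * a / b)" for a b c :: real by simp
  ultimately show ?thesis
    unfolding binom_2p_minus_1_central by (simp only:)
qed

text \<open>
  The ratio of the neighbours \<open>binom (2 p) (p + j + 1)\<close> and \<open>binom (2 p) (p + j)\<close> is
  \<open>(p - j) / (p + j + 1)\<close>.  For \<open>p < j\<close> both vanish, so the resulting rational function is correct,
  and has no pole, at every \<open>p\<close>.
\<close>

lemma int_choose_even_nat: "\<exists>f. rational_on UNIV f \<and> (\<forall>p. int_choose (2 * p) (int p + int j) = binom_2p_minus_1 p * f p)"
proof (induction j)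
  case 0
  have "int_choose (2 * p) (int p + int 0) = binom_2p_minus_1 p * 2" for p
    by (simp add: int_choose_def binom_2p_minus_1_central)
  then show ?case by (intro exI[of _ "\<lambda>_. 2"]) (simp add: rational_on_const)
next
  case (Suc j)
  then obtain f where f: "rational_on UNIV f" "\<And>p. int_choose (2 * p) (int p + int j) = binom_2p_minus_1 p * f p"
    by blast
  have step: "int_choose (2 * p) (int p + int (Suc j)) = int_choose (2 * p) (int p + int j) * ((real p - real j) / (real p + (real j + 1)))" for p
  proof -
    have n: "nat (int p + int i) = p + i" for i by (simp flip: of_nat_add)
    have "real ((2 * p) choose (p + Suc j)) * (real p + (real j + 1)) = real ((2 * p) choose (p + j)) * (real p - real j)"
    proof (cases "j \<le> p")
      case True
      have "Suc (p + j) * ((2 * p) choose Suc (p + j)) = (2 * p - (p + j)) * ((2 * p) choose (p + j))"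
        using binomial_absorption[of "p + j" "2 * p"] binomial_absorb_comp[of "2 * p" "p + j"] by simp
      moreover have "2 * p - (p + j) = p - j" by simp
      ultimately have "real (Suc (p + j)) * real ((2 * p) choose Suc (p + j)) = real (p - j) * real ((2 * p) choose (p + j))"
        by (metis of_nat_mult)
      then show ?thesis using True by (simp add: of_nat_diff algebra_simps)
    qed (simp add: binomial_eq_0)
    then show ?thesis unfolding int_choose_def n by (simp add: field_simps)
  qed
  have "rational_on UNIV (\<lambda>p. f p * ((real p - real j) / (real p + (real j + 1))))"
    using rational_on_linear[of UNIV 1 "- real j"] rational_on_linear[of UNIV 1 "real j + 1"]
    by (intro rational_on_mult f(1) rational_on_divide) simp_all
  then show ?case
    by (intro exI[of _ "\<lambda>p. f p * ((real p - real j) / (real p + (real j + 1)))"]) (simp only: step f(2), simp)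
qed

lemma int_choose_even: "\<exists>f. rational_on UNIV f \<and> (\<forall>p. int_choose (2 * p) (int p + j) = binom_2p_minus_1 p * f p)"
proof -
  have sym: "int_choose (2 * p) (int p - int i) = int_choose (2 * p) (int p + int i)" for p i
  proof (cases "i \<le> p")
    case True
    have "nat (int p - int i) = p - i" "nat (int p + int i) = p + i" using True by linarith+
    then show ?thesis
      using True binomial_symmetric[of "p - i" "2 * p"] by (simp add: int_choose_def add.commute)
  next
    case False
    then have "nat (int p + int i) = p + i" by linarith
    then show ?thesis using False by (simp add: int_choose_def binomial_eq_0)
  qed
  show ?thesis
  proof (cases "j \<ge> 0")
    case True
    then show ?thesis using int_choose_even_nat[of "nat j"] by simp
  next
    case False
    then have "j = - int (nat (- j))" by simp
    then show ?thesis using int_choose_even_nat[of "nat (- j)"] sym[of _ "nat (- j)"]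
      by (metis (no_types, lifting) add_uminus_conv_diff)
  qed
qed

lemma int_choose_odd: "\<exists>f. rational_on UNIV f \<and> (\<forall>p. int_choose (2 * p + 1) (int p + j) = binom_2p_minus_1 p * f p)"
proof -
  obtain f where f: "rational_on UNIV f" "\<And>p. int_choose (2 * p) (int p + j) = binom_2p_minus_1 p * f p"
    using int_choose_even by blast
  obtain g where g: "rational_on UNIV g" "\<And>p. int_choose (2 * p) (int p + (j - 1)) = binom_2p_minus_1 p * g p"
    using int_choose_even by blast
  have "int_choose (2 * p + 1) (int p + j) = binom_2p_minus_1 p * (f p + g p)" for p
    using int_choose_Suc[of "2 * p" "int p + j"] f(2)[of p] g(2)[of p] by (simp add: algebra_simps)
  then show ?thesis
    using rational_on_add[OF f(1) g(1)] by blast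
qed

text \<open>
  Krawtchouk values in the coordinates \<open>s = 2 a - k\<close>, \<open>t = 2 b - k\<close>, which stay fixed when the size
  of the diamond grows.
\<close>

definition kraw_centred :: "int \<Rightarrow> int \<Rightarrow> nat \<Rightarrow> real" where
  "kraw_centred s t k = (if even (int k + s) \<and> even (int k + t) then kraw k ((int k + s) div 2) ((int k + t) div 2) else 0)"

definition kraw_weight :: "nat \<Rightarrow> real" where
  "kraw_weight p = (- 1) ^ p * binom_2p_minus_1 p"

lemma kraw_weight_Suc: "kraw_weight (Suc p) = kraw_weight p * (- (2 * (2 * real p + 1) / (real p + 1)))"
  by (simp add: kraw_weight_def binom_2p_minus_1_Suc)

lemma rational_ratio: "rational_on UNIV (\<lambda>p. 2 * (2 * real p + 1) / (real p + 1))"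
  using rational_on_linear[of UNIV 4 2] rational_on_linear[of UNIV 1 1]
  by (intro rational_on_divide) (simp_all add: algebra_simps)

lemma rational_multiple_kraw_pred:
  assumes "rational_multiple kraw_weight a n0"
  shows "rational_multiple kraw_weight (\<lambda>k. a (k - 1)) (Suc n0)"
proof (rule rational_multiple_pred[OF assms kraw_weight_Suc])
  show "rational_on UNIV (\<lambda>p. - (2 * (2 * real p + 1) / (real p + 1)))"
    using rational_on_mult[OF rational_on_const[of _ "- 1"] rational_ratio] unfolding mult_minus1 .
  show "- (2 * (2 * real p + 1) / (real p + 1)) \<noteq> 0" for p by simp
qed

text \<open>
  By \<open>kraw_middle\<close> with \<open>k = 2 q\<close> the value is \<open>\<plusminus> binom q (a / 2)\<close> for even \<open>a = q + s / 2\<close>, and 0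
  otherwise.  For \<open>k = 4 p\<close> this is a binomial coefficient \<open>binom (2 p) (p + j)\<close> with \<open>s = 4 j\<close>, and for
  \<open>k = 4 p + 2\<close> it is \<open>binom (2 p + 1) (p + j + 1)\<close> with \<open>s = 4 j + 2\<close>.
\<close>

lemma rational_multiple_column_0: "rational_multiple kraw_weight (kraw_centred s 0) 0"
proof (rule rational_multipleI)
  fix \<alpha> :: nat assume "\<alpha> < 4"
  then consider "\<alpha> = 0" | "\<alpha> = 2" | "odd \<alpha>"
    using less_4_cases by fastforce
  then show "\<exists>f. rational_on {p. 0 \<le> 4 * p + \<alpha>} f \<and> (\<forall>p. 0 \<le> 4 * p + \<alpha> \<longrightarrow> kraw_centred s 0 (4 * p + \<alpha>) = kraw_weight p * f p)"
  proof cases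
    case 3
    then have "kraw_centred s 0 (4 * p + \<alpha>) = 0" for p by (simp add: kraw_centred_def)
    then show ?thesis by (intro exI[of _ "\<lambda>_. 0"]) (simp add: rational_on_const)
  next
    case 1
    show ?thesis
    proof (cases "4 dvd s")
      case True
      then obtain j where s: "s = 4 * j" by blast
      obtain f where f: "rational_on UNIV f" "\<And>p. int_choose (2 * p) (int p + j) = binom_2p_minus_1 p * f p"
        using int_choose_even by blast
      have "kraw_centred s 0 (4 * p + \<alpha>) = kraw_weight p * (int_sign j * f p)" for p
      proof -
        have "(int (4 * p) + s) div 2 = 2 * (int p + j)" "int (4 * p) div 2 = int (2 * p)" using s by simp_all
        moreover have "even (int (4 * p) + s)" using s by simp
        ultimately have "kraw_centred s 0 (4 * p + \<alpha>) = kraw (2 * (2 * p)) (2 * (int p + j)) (int (2 * p))"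
          by (simp add: kraw_centred_def 1)
        also have "\<dots> = kraw_weight p * (int_sign j * f p)"
          unfolding kraw_middle by (simp add: f(2) int_sign_add kraw_weight_def)
        finally show ?thesis .
      qed
      moreover have "rational_on UNIV (\<lambda>p. int_sign j * f p)" by (intro rational_on_mult rational_on_const f(1))
      ultimately show ?thesis by auto
    next
      case False
      have "kraw_centred s 0 (4 * p + \<alpha>) = 0" for p
      proof (cases "even s")
        case True
        then obtain i where i: "s = 2 * i" by blast
        with False have odd: "odd i" by auto
        have "(int (4 * p) + s) div 2 = 2 * int p + i" "int (4 * p) div 2 = int (2 * p)" using i by simp_all
        then have "kraw_centred s 0 (4 * p + \<alpha>) = kraw (2 * (2 * p)) (2 * int p + i) (int (2 * p))"
          using i by (simp add: kraw_centred_def 1)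
        then show ?thesis unfolding kraw_middle using odd by simp
      qed (simp add: kraw_centred_def 1)
      then show ?thesis by (intro exI[of _ "\<lambda>_. 0"]) (simp add: rational_on_const)
    qed
  next
    case 2
    show ?thesis
    proof (cases "4 dvd s - 2")
      case True
      then obtain j where "s - 2 = 4 * j" by blast
      then have s: "s = 4 * j + 2" by simp
      obtain f where f: "rational_on UNIV f" "\<And>p. int_choose (2 * p + 1) (int p + (j + 1)) = binom_2p_minus_1 p * f p"
        using int_choose_odd by blast
      have "kraw_centred s 0 (4 * p + \<alpha>) = kraw_weight p * (int_sign (j + 1) * f p)" for p
      proof -
        have "(int (4 * p + 2) + s) div 2 = 2 * (int p + (j + 1))" "int (4 * p + 2) div 2 = int (2 * p + 1)"
          using s by simp_all
        moreover have "even (int (4 * p + 2) + s)" using s by simp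
        moreover have "even (int (4 * p + 2) + 0)" by simp
        moreover have "4 * p + 2 = 2 * (2 * p + 1)" by simp
        ultimately have "kraw_centred s 0 (4 * p + \<alpha>) = kraw (2 * (2 * p + 1)) (2 * (int p + (j + 1))) (int (2 * p + 1))"
          unfolding kraw_centred_def 2 by (metis add.right_neutral)
        also have "\<dots> = kraw_weight p * (int_sign (j + 1) * f p)"
          unfolding kraw_middle using f(2)[of p] int_sign_add[of p "j + 1"] by (simp add: kraw_weight_def)
        finally show ?thesis .
      qed
      moreover have "rational_on UNIV (\<lambda>p. int_sign (j + 1) * f p)" by (intro rational_on_mult rational_on_const f(1))
      ultimately show ?thesis by auto
    next
      case False
      have "kraw_centred s 0 (4 * p + \<alpha>) = 0" for p
      proof (cases "even s")
        case True
        then obtain i where i: "s = 2 * i" by blast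
        have i_even: "even i"
        proof (rule ccontr)
          assume "odd i"
          then obtain h where "i = 2 * h + 1" by (elim oddE)
          with i have "s - 2 = 4 * h" by simp
          then show False using False by simp
        qed
        have "(int (4 * p + 2) + s) div 2 = 2 * int p + 1 + i" "int (4 * p + 2) div 2 = int (2 * p + 1)" using i by simp_all
        moreover have "4 * p + 2 = 2 * (2 * p + 1)" by simp
        ultimately have "kraw_centred s 0 (4 * p + \<alpha>) = kraw (2 * (2 * p + 1)) (2 * int p + 1 + i) (int (2 * p + 1)) \<or> kraw_centred s 0 (4 * p + \<alpha>) = 0"
          unfolding kraw_centred_def 2 by (metis add.right_neutral)
        moreover have "kraw (2 * (2 * p + 1)) (2 * int p + 1 + i) (int (2 * p + 1)) = 0"
          unfolding kraw_middle using i_even by simp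
        ultimately show ?thesis by auto
      qed (simp add: kraw_centred_def 2)
      then show ?thesis by (intro exI[of _ "\<lambda>_. 0"]) (simp add: rational_on_const)
    qed
  qed
qed

lemma kraw_centred_1: "kraw_centred s 1 (Suc k) = kraw_centred (s + 1) 0 k - kraw_centred (s - 1) 0 k"
proof (cases "even (int k) \<and> even (int k + s + 1)")
  case True
  then obtain q where q: "k = 2 * q" by auto
  obtain a where a: "int k + s + 1 = 2 * a" using True by blast
  have divs: "(int (Suc k) + s) div 2 = a" "(int (Suc k) + 1) div 2 = int q + 1" "(int k + (s + 1)) div 2 = a"
    "(int k + (s - 1)) div 2 = a - 1" "(int k + 0) div 2 = int q"
    using a q by simp_all
  have parities: "even (int (Suc k) + s)" "even (int k + (s + 1))" "even (int k + (s - 1))"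
    "even (int (Suc k) + 1)" "even (int k + 0)"
    using True by presburger+
  have "kraw (Suc k) a (int q + 1) = kraw k a (int q) - kraw k (a - 1) (int q)"
    using q by (intro kraw_Suc_Suc) simp_all
  then show ?thesis
    unfolding kraw_centred_def divs by (simp only: parities if_True simp_thms)
next
  case False
  then have "\<not> (even (int (Suc k) + s) \<and> even (int (Suc k) + 1))"
    "\<not> (even (int k + (s + 1)) \<and> even (int k + 0))" "\<not> (even (int k + (s - 1)) \<and> even (int k + 0))"
    by presburger+
  then show ?thesis unfolding kraw_centred_def by (simp only: if_False)
qed

text \<open>
  Half the sum of multiplication by \<open>1 + z\<close> and multiplication by \<open>1 - z\<close> is the identity.  The
  hypothesis says that the column \<open>t + 1\<close> exists at level \<open>k\<close>.
\<close>

lemma kraw_centred_add: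
  assumes "\<bar>t + 1\<bar> \<le> int k"
  shows "kraw_centred s t (Suc k) + kraw_centred s (t + 2) (Suc k) = 2 * kraw_centred (s + 1) (t + 1) k"
proof (cases "even (int k + s + 1) \<and> even (int k + t + 1)")
  case True
  obtain a where a: "int k + s + 1 = 2 * a" using True by blast
  obtain b where b: "int k + t + 1 = 2 * b" using True by blast
  have divs: "(int (Suc k) + s) div 2 = a" "(int (Suc k) + t) div 2 = b" "(int (Suc k) + (t + 2)) div 2 = b + 1"
    "(int k + (s + 1)) div 2 = a" "(int k + (t + 1)) div 2 = b"
    using a b by simp_all
  have parities: "even (int (Suc k) + s)" "even (int (Suc k) + t)" "even (int (Suc k) + (t + 2))"
    "even (int k + (s + 1))" "even (int k + (t + 1))"
    using True by presburger+
  have "0 \<le> b" "b \<le> int k" using assms b by linarith+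
  then have "kraw (Suc k) a b + kraw (Suc k) a (b + 1) = 2 * kraw k a b"
    using kraw_Suc_Suc[of b k a] kraw_Suc[of b k a] by simp
  then show ?thesis
    unfolding kraw_centred_def divs by (simp only: parities if_True simp_thms)
next
  case False
  then have "\<not> (even (int (Suc k) + s) \<and> even (int (Suc k) + t))"
    "\<not> (even (int (Suc k) + s) \<and> even (int (Suc k) + (t + 2)))" "\<not> (even (int k + (s + 1)) \<and> even (int k + (t + 1)))"
    by presburger+
  then show ?thesis unfolding kraw_centred_def by (simp only: if_False mult_zero_right add_0)
qed

lemma rational_multiple_column_1: "rational_multiple kraw_weight (kraw_centred s 1) 1"
proof -
  have "rational_multiple kraw_weight (\<lambda>k. 1 * kraw_centred (s + 1) 0 (k - 1) + (- 1) * kraw_centred (s - 1) 0 (k - 1)) (Suc 0)"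
    by (intro rational_multiple_linear rational_multiple_kraw_pred rational_multiple_column_0)
  then show ?thesis
  proof (rule rational_multiple_cong)
    fix k :: nat assume "1 \<le> k"
    then show "kraw_centred s 1 k = 1 * kraw_centred (s + 1) 0 (k - 1) + (- 1) * kraw_centred (s - 1) 0 (k - 1)"
      using kraw_centred_1[of s "k - 1"] by simp
  qed simp
qed

text \<open>
  Solve \<open>kraw_centred_add\<close> for the column farther from the middle, on either side.  The bound \<open>\<bar>t\<bar>\<close>
  is preserved because the level decreases by one while the column moves by one.
\<close>

lemma rational_multiple_column_step:
  assumes "rational_multiple kraw_weight (kraw_centred s t) (nat \<bar>t\<bar>)" "rational_multiple kraw_weight (kraw_centred (s + 1) t1) (nat \<bar>t1\<bar>)"
    and "\<bar>t1\<bar> = \<bar>t\<bar> + 1" "\<bar>t2\<bar> = \<bar>t\<bar> + 2" "t1 = t + 1 \<and> t2 = t + 2 \<or> t1 = t - 1 \<and> t2 = t - 2"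
  shows "rational_multiple kraw_weight (kraw_centred s t2) (nat \<bar>t2\<bar>)"
proof -
  have n: "nat \<bar>t2\<bar> = Suc (nat \<bar>t1\<bar>)" "nat \<bar>t\<bar> \<le> nat \<bar>t2\<bar>" using assms(3,4) by linarith+
  have "rational_multiple kraw_weight (kraw_centred s t) (Suc (nat \<bar>t1\<bar>))"
    using assms(1) n by (intro rational_multiple_cong[OF assms(1)]) auto
  then have "rational_multiple kraw_weight (\<lambda>k. 2 * kraw_centred (s + 1) t1 (k - 1) + (- 1) * kraw_centred s t k) (Suc (nat \<bar>t1\<bar>))"
    by (intro rational_multiple_linear rational_multiple_kraw_pred assms(2))
  then show ?thesis unfolding n(1)
  proof (rule rational_multiple_cong)
    fix k assume k: "Suc (nat \<bar>t1\<bar>) \<le> k"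
    then obtain k' where k': "k = Suc k'" "\<bar>t1\<bar> \<le> int k'" by (cases k) auto
    from assms(5) show "kraw_centred s t2 k = 2 * kraw_centred (s + 1) t1 (k - 1) + (- 1) * kraw_centred s t k"
    proof
      assume "t1 = t + 1 \<and> t2 = t + 2"
      then show ?thesis using kraw_centred_add[of t k' s] k' by simp
    next
      assume "t1 = t - 1 \<and> t2 = t - 2"
      then show ?thesis using kraw_centred_add[of "t - 2" k' s] k' by simp
    qed
  qed simp
qed

lemma rational_multiple_column_minus_1: "rational_multiple kraw_weight (kraw_centred s (- 1)) 1"
proof -
  have "rational_multiple kraw_weight (\<lambda>k. 2 * kraw_centred (s + 1) 0 (k - 1) + (- 1) * kraw_centred s 1 k) (Suc 0)"
    using rational_multiple_column_1 by (intro rational_multiple_linear rational_multiple_kraw_pred rational_multiple_column_0) simp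
  then show ?thesis
  proof (rule rational_multiple_cong)
    fix k :: nat assume "1 \<le> k"
    then show "kraw_centred s (- 1) k = 2 * kraw_centred (s + 1) 0 (k - 1) + (- 1) * kraw_centred s 1 k"
      using kraw_centred_add[of "- 1" "k - 1" s] by simp
  qed simp
qed

lemma rational_multiple_kraw: "rational_multiple kraw_weight (kraw_centred s t) (nat \<bar>t\<bar>)"
proof -
  have "rational_multiple kraw_weight (kraw_centred s (int i)) i \<and> rational_multiple kraw_weight (kraw_centred s (- int i)) i" for s i
  proof (induction i arbitrary: s rule: less_induct)
    case (less i)
    consider "i = 0" | "i = 1" | j where "i = Suc (Suc j)" by (metis One_nat_def not0_implies_Suc)
    then show ?case
    proof cases
      case 1
      then show ?thesis using rational_multiple_column_0 by simp
    next
      case 2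
      then show ?thesis using rational_multiple_column_1 rational_multiple_column_minus_1 by simp
    next
      case (3 j)
      have IH: "rational_multiple kraw_weight (kraw_centred s (int j)) j" "rational_multiple kraw_weight (kraw_centred s (- int j)) j"
        "rational_multiple kraw_weight (kraw_centred (s + 1) (int (Suc j))) (Suc j)" "rational_multiple kraw_weight (kraw_centred (s + 1) (- int (Suc j))) (Suc j)"
        using less.IH[of j s] less.IH[of "Suc j" "s + 1"] 3 by simp_all
      have *: "nat \<bar>int m\<bar> = m" "nat \<bar>- int m\<bar> = m" for m by simp_all
      show ?thesis
        using rational_multiple_column_step[of s "int j" "int (Suc j)" "int i", unfolded *]
          rational_multiple_column_step[of s "- int j" "- int (Suc j)" "- int i", unfolded *] IH 3
        by simp
    qed
  qed
  from this[of s "nat \<bar>t\<bar>"] show ?thesis by (cases "t \<ge> 0") simp_all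
qed

lemma wave_eq_kraw_centred: "wave (Suc k) x y = (1 / 2) ^ k * (kraw_centred (x + y) (x - y) k * kraw_centred (x - y) (x + y) k)"
proof (cases "even (int k + x + y)")
  case True
  obtain a where a: "int k + x + y = 2 * a" using True by blast
  define b where "b = a - y"
  have b: "int k + x - y = 2 * b" using a by (simp add: b_def)
  have xy: "x = a + b - int k" "y = a - b" using a b by linarith+
  have "kraw_centred (x + y) (x - y) k = kraw k a b" "kraw_centred (x - y) (x + y) k = kraw k b a"
    unfolding kraw_centred_def xy by simp_all
  then show ?thesis
    unfolding xy using wave_eq_kraw2[of k a b] by (simp add: xy[symmetric] kraw2_def power_one_over field_simps)
next
  case False
  then have "wave (Suc k) x y = 0" by (intro wave_parity) presburger
  moreover have "kraw_centred (x + y) (x - y) k = 0"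
  proof -
    have "\<not> even (int k + (x + y))" using False by (simp add: add.assoc)
    then show ?thesis by (simp only: kraw_centred_def simp_thms if_False)
  qed
  ultimately show ?thesis by simp
qed

definition prob_weight :: "nat \<Rightarrow> real" where
  "prob_weight p = (1 / 16) ^ p * (kraw_weight p * kraw_weight p)"

text \<open>
  The signs \<open>(- 1) ^ p\<close> of the two Krawtchouk factors cancel.
\<close>

lemma prob_weight_eq: "prob_weight p = (binom_2p_minus_1 p)\<^sup>2 / 16 ^ p"
proof -
  have "((- 1) ^ p * (- 1) ^ p :: real) = 1" by (simp flip: power_add power_mult_distrib)
  then have "kraw_weight p * kraw_weight p = (binom_2p_minus_1 p)\<^sup>2"
    by (simp add: kraw_weight_def power2_eq_square mult.assoc mult.left_commute)
  then show ?thesis by (simp add: prob_weight_def power_one_over)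
qed

lemma prob_weight_Suc: "prob_weight (Suc p) = prob_weight p * ((1 / 16) * (2 * (2 * real p + 1) / (real p + 1)) * (2 * (2 * real p + 1) / (real p + 1)))"
  unfolding prob_weight_def kraw_weight_Suc power_Suc mult_minus_right mult_minus_left minus_minus by (simp only: mult_ac)

lemma rational_multiple_prob_Suc: "rational_multiple prob_weight a n0 \<Longrightarrow> rational_multiple prob_weight (\<lambda>n. a (Suc n)) (n0 - 1)"
  by (erule rational_multiple_Suc, rule prob_weight_Suc) (intro rational_on_mult rational_on_const rational_ratio)

lemma rational_multiple_prob_pred: "rational_multiple prob_weight a n0 \<Longrightarrow> rational_multiple prob_weight (\<lambda>n. a (n - 1)) (Suc n0)"
  by (erule rational_multiple_pred, rule prob_weight_Suc) (intro rational_on_mult rational_on_const rational_ratio, simp)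

text \<open>
  Both factors are taken at offsets of absolute value at most \<open>\<bar>x\<bar> + \<bar>y\<bar>\<close>.  The wave at time \<open>n\<close>
  corresponds to the level \<open>n - 1\<close>, hence the successor in the bound.
\<close>

lemma rational_multiple_wave: "rational_multiple prob_weight (\<lambda>n. wave n x y) (Suc (nat (\<bar>x\<bar> + \<bar>y\<bar>)))"
proof -
  let ?N = "nat (\<bar>x\<bar> + \<bar>y\<bar>)"
  have "nat \<bar>x - y\<bar> \<le> ?N" "nat \<bar>x + y\<bar> \<le> ?N" by linarith+
  then have kraw_centred: "rational_multiple kraw_weight (kraw_centred (x + y) (x - y)) ?N" "rational_multiple kraw_weight (kraw_centred (x - y) (x + y)) ?N"
    using rational_multiple_cong[OF rational_multiple_kraw refl] by blast+
  have "rational_multiple prob_weight (\<lambda>k. (1 / 2) ^ k * (kraw_centred (x + y) (x - y) k * kraw_centred (x - y) (x + y) k)) ?N"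
    unfolding prob_weight_def[abs_def] by (intro rational_multiple_mult rational_multiple_half_power kraw_centred)
  then have "rational_multiple prob_weight (\<lambda>k. wave (Suc k) x y) ?N"
    unfolding wave_eq_kraw_centred .
  from rational_multiple_prob_pred[OF this] show ?thesis
    by (rule rational_multiple_cong) auto
qed

section \<open>Excess of the placement probability over one quarter\<close>

text \<open>
  The value 0 at the points of the other parity, where the wave vanishes too, makes the recurrences hold
  for all \<open>x\<close>, \<open>y\<close> and \<open>n\<close>.
\<close>

definition excess :: "int \<Rightarrow> int \<Rightarrow> nat \<Rightarrow> real" where
  "excess x y n = (if odd (x + y + int n) then hprob n x y - 1 / 4 else 0)"

text \<open>
  The constants \<open>1/4\<close> cancel, because shuffling preserves the parity of \<open>x + y + n\<close>; for the other
  parity the wave vanishes.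
\<close>

lemma excess_step:
  "excess x y (Suc n) = excess x (y - 1) n + wave (Suc n) x y / 2"
proof (cases "odd (x + y + int (Suc n))")
  case True
  moreover from this have "odd (x + (y - 1) + int n)" by presburger
  ultimately show ?thesis using hprob_wave[OF True] by (simp only: excess_def if_True) simp
next
  case False
  moreover from this have "\<not> odd (x + (y - 1) + int n)" by presburger
  moreover from False have "wave (Suc n) x y = 0" by (intro wave_parity) blast
  ultimately show ?thesis by (simp only: excess_def if_False; simp)
qed

text \<open>
  The four constants \<open>1/4\<close> cancel against the indicator of the cell.
\<close>

lemma excess_sum_reflections:
  assumes "\<bar>x\<bar> + \<bar>y\<bar> \<le> int n"
  shows "excess x y (Suc n) + excess x (- y) (Suc n) + excess y x (Suc n) + excess y (- x) (Suc n)
    = wave (Suc n) x y"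
proof (cases "odd (x + y + int (Suc n))")
  case True
  moreover from this have "odd (x + - y + int (Suc n))" "odd (y + x + int (Suc n))" "odd (y + - x + int (Suc n))"
    by presburger+
  moreover have "cell_indicator (Suc n) x y = 1" using assms by (simp add: cell_indicator_def)
  ultimately show ?thesis using hprob_sum_reflections[OF True] by (simp only: excess_def if_True) simp
next
  case False
  moreover from this have "\<not> odd (x + - y + int (Suc n))" "\<not> odd (y + x + int (Suc n))" "\<not> odd (y + - x + int (Suc n))"
    by presburger+
  moreover from False have "wave (Suc n) x y = 0" by (intro wave_parity) blast
  ultimately show ?thesis by (simp only: excess_def if_False; simp)
qed

abbreviation excess_regular_at :: "int \<Rightarrow> int \<Rightarrow> bool" where
  "excess_regular_at x y \<equiv> rational_multiple prob_weight (excess x y) (Suc (nat (\<bar>x\<bar> + \<bar>y\<bar>)))"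

lemma excess_regular_up:
  assumes "excess_regular_at x y" "0 \<le> y"
  shows "excess_regular_at x (y + 1)"
proof -
  have N: "Suc (nat (\<bar>x\<bar> + \<bar>y + 1\<bar>)) = Suc (Suc (nat (\<bar>x\<bar> + \<bar>y\<bar>)))" using assms(2) by linarith
  have "rational_multiple prob_weight (\<lambda>n. 1 * excess x y (n - 1) + (1 / 2) * wave n x (y + 1)) (Suc (nat (\<bar>x\<bar> + \<bar>y + 1\<bar>)))"
    using rational_multiple_prob_pred[OF assms(1)] by (intro rational_multiple_linear rational_multiple_wave) (simp only: N)
  then show ?thesis
  proof (rule rational_multiple_cong)
    fix n assume "Suc (nat (\<bar>x\<bar> + \<bar>y + 1\<bar>)) \<le> n"
    then obtain k where "n = Suc k" by (cases n) auto
    then show "excess x (y + 1) n = 1 * excess x y (n - 1) + (1 / 2) * wave n x (y + 1)"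
      using excess_step[of x "y + 1" k] by simp
  qed simp
qed

text \<open>
  The same recurrence as for \<open>excess_regular_up\<close>, solved for the earlier time.
\<close>

lemma excess_regular_down:
  assumes "excess_regular_at x y" "y \<le> 0"
  shows "excess_regular_at x (y - 1)"
proof -
  let ?N = "Suc (nat (\<bar>x\<bar> + \<bar>y - 1\<bar>))"
  have "rational_multiple prob_weight (\<lambda>n. excess x y (Suc n)) ?N"
    by (rule rational_multiple_cong[OF rational_multiple_prob_Suc[OF assms(1)]]) (use assms(2) in auto)
  moreover have "rational_multiple prob_weight (\<lambda>n. wave (Suc n) x y) ?N"
    by (rule rational_multiple_cong[OF rational_multiple_prob_Suc[OF rational_multiple_wave]]) (use assms(2) in auto)
  ultimately have "rational_multiple prob_weight (\<lambda>n. 1 * excess x y (Suc n) + (- 1 / 2) * wave (Suc n) x y) ?N"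
    by (rule rational_multiple_linear)
  then show ?thesis
    by (rule rational_multiple_cong) (simp_all add: excess_step)
qed

lemma excess_regular_column:
  assumes "excess_regular_at x 0"
  shows "excess_regular_at x y"
proof -
  have "excess_regular_at x (int j) \<and> excess_regular_at x (- int j)" for j
  proof (induction j)
    case (Suc j)
    have "int (Suc j) = int j + 1" "- int (Suc j) = - int j - 1" by simp_all
    then show ?case
      using excess_regular_up[of x "int j"] excess_regular_down[of x "- int j"] Suc.IH
      by (simp only: of_nat_0_le_iff neg_le_0_iff_le simp_thms)
  qed (use assms in simp)
  from this[of "nat \<bar>y\<bar>"] show ?thesis by (cases "y \<ge> 0") simp_all
qed

text \<open>
  At the origin the four terms of \<open>excess_sum_reflections\<close> coincide.  At \<open>(x, 0)\<close> two of them coincide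
  and the other two lie in the column through the origin.
\<close>

lemma excess_regular: "excess_regular_at x y"
proof (rule excess_regular_column)
  let ?N = "Suc (nat (\<bar>x\<bar> + \<bar>0\<bar>))"
  have "rational_multiple prob_weight (\<lambda>n. (1 / 4) * wave n 0 0 + 0 * wave n 0 0) (Suc (nat (\<bar>0\<bar> + \<bar>0\<bar>)))"
    by (intro rational_multiple_linear rational_multiple_wave)
  then have centre: "excess_regular_at 0 0"
  proof (rule rational_multiple_cong)
    fix n assume "Suc (nat (\<bar>0\<bar> + \<bar>0\<bar>)) \<le> n"
    then obtain k where "n = Suc k" by (cases n) auto
    then show "excess 0 0 n = (1 / 4) * wave n 0 0 + 0 * wave n 0 0"
      using excess_sum_reflections[of 0 0 k] by simp
  qed simp
  have col: "rational_multiple prob_weight (excess 0 x) ?N" "rational_multiple prob_weight (excess 0 (- x)) ?N"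
    using excess_regular_column[OF centre, of x] excess_regular_column[OF centre, of "- x"]
    by (simp_all add: add.commute)
  have "rational_multiple prob_weight (\<lambda>n. (1 / 2) * wave n x 0 + (- 1 / 2) * (1 * excess 0 x n + 1 * excess 0 (- x) n)) ?N"
    by (intro rational_multiple_linear rational_multiple_wave col)
  then show "excess_regular_at x 0"
  proof (rule rational_multiple_cong)
    fix n assume n: "?N \<le> n"
    then obtain k where k: "n = Suc k" by (cases n) auto
    with n have "\<bar>x\<bar> + \<bar>0\<bar> \<le> int k" by linarith
    from excess_sum_reflections[OF this]
    show "excess x 0 n = (1 / 2) * wave n x 0 + (- 1 / 2) * (1 * excess 0 x n + 1 * excess 0 (- x) n)"
      by (simp add: k field_simps)
  qed simp
qed

section \<open>Tilings of the region as matchings of its squares\<close>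

definition region :: "(int \<times> int) set \<Rightarrow> (real \<times> real) set" where
  "region A = (\<Union>c\<in>A. unit_square c)"

definition centre :: "int \<times> int \<Rightarrow> real \<times> real" where
  "centre c = (real_of_int (fst c) + 1 / 2, real_of_int (snd c) + 1 / 2)"

text \<open>
  The squares of a union of unit squares are recovered from their centres.
\<close>

definition squares_of :: "(real \<times> real) set \<Rightarrow> (int \<times> int) set" where
  "squares_of X = {c. centre c \<in> X}"

lemma unit_square_floor:
  assumes "(x, y) \<in> unit_square c" "x \<notin> \<int>" "y \<notin> \<int>"
  shows "c = (\<lfloor>x\<rfloor>, \<lfloor>y\<rfloor>)"
proof -
  have *: "a = \<lfloor>z\<rfloor>" if "real_of_int a \<le> z" "z \<le> real_of_int a + 1" "z \<notin> \<int>" for a z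
  proof -
    have "z \<noteq> real_of_int (a + 1)" using that(3) by (metis Ints_of_int)
    then show ?thesis using that by (intro floor_unique[symmetric]) auto
  qed
  show ?thesis
    using assms(1) *[OF _ _ assms(2), of "fst c"] *[OF _ _ assms(3), of "snd c"]
    by (cases c) (simp add: unit_square_def)
qed

lemma half_not_Ints: "real_of_int a + 1 / 2 \<notin> \<int>"
proof
  assume "real_of_int a + 1 / 2 \<in> \<int>"
  then obtain b where "real_of_int a + 1 / 2 = real_of_int b" by (elim Ints_cases)
  then have "real_of_int (2 * a + 1) = real_of_int (2 * b)" by simp
  then have "2 * a + 1 = 2 * b" by (simp only: of_int_eq_iff)
  then show False by presburger
qed

lemma centre_in_unit_square_iff: "centre c \<in> unit_square d \<longleftrightarrow> c = d"
proof
  assume "centre c \<in> unit_square d"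
  then have "d = (\<lfloor>real_of_int (fst c) + 1 / 2\<rfloor>, \<lfloor>real_of_int (snd c) + 1 / 2\<rfloor>)"
    unfolding centre_def by (rule unit_square_floor) (rule half_not_Ints)+
  moreover have "\<lfloor>real_of_int a + 1 / 2\<rfloor> = a" for a by linarith
  ultimately show "c = d" by simp
qed (auto simp: centre_def unit_square_def)

lemma squares_of_region: "squares_of (region A) = A"
  by (auto simp: squares_of_def region_def centre_in_unit_square_iff)

lemma region_inject: "region A = region B \<longleftrightarrow> A = B"
  by (metis squares_of_region)

lemma region_Union: "region (\<Union>M) = \<Union>(region ` M)"
  by (auto simp: region_def)

lemma centre_in_interior:
  assumes "c \<in> A"
  shows "centre c \<in> interior (region A)"
proof -
  have "centre c \<in> interior (unit_square c)"
    by (simp add: unit_square_def interior_Times centre_def)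
  moreover have "interior (unit_square c) \<subseteq> interior (region A)"
    using assms by (intro interior_mono) (auto simp: region_def)
  ultimately show ?thesis by blast
qed

text \<open>
  Points with two coordinates outside \<open>\<int>\<close> lie in a unique unit square; they avoid all edges.
\<close>

lemma open_contains_nonint:
  fixes U :: "real set"
  assumes "open U" "u \<in> U"
  shows "\<exists>x\<in>U. x \<notin> \<int>"
proof (rule ccontr)
  assume *: "\<not> (\<exists>x\<in>U. x \<notin> \<int>)"
  obtain e where e: "e > 0" "ball u e \<subseteq> U" using assms open_contains_ball by blast
  have "{u - e<..<u + e} \<subseteq> range (of_int :: int \<Rightarrow> real)"
    using e(2) * by (auto simp: ball_def dist_real_def Ints_def subset_iff)
  then have "countable {u - e<..<u + e}" by (rule countable_subset) simp
  then show False using e(1) uncountable_open_interval[of "u - e" "u + e"] by simp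
qed

lemma interior_region_disjoint_iff:
  "interior (region A) \<inter> interior (region B) = {} \<longleftrightarrow> A \<inter> B = {}"
proof
  assume "interior (region A) \<inter> interior (region B) = {}"
  then show "A \<inter> B = {}" using centre_in_interior by blast
next
  assume AB: "A \<inter> B = {}"
  show "interior (region A) \<inter> interior (region B) = {}"
  proof (rule ccontr)
    assume "interior (region A) \<inter> interior (region B) \<noteq> {}"
    then obtain z where "z \<in> interior (region A) \<inter> interior (region B)" by blast
    moreover have "open (interior (region A) \<inter> interior (region B))" by blast
    ultimately obtain U V where UV: "open U" "open V" "z \<in> U \<times> V" "U \<times> V \<subseteq> interior (region A) \<inter> interior (region B)"
      by (metis open_prod_elim)
    obtain x where x: "x \<in> U" "x \<notin> \<int>" using open_contains_nonint[OF UV(1)] UV(3) by (metis mem_Times_iff)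
    obtain y where y: "y \<in> V" "y \<notin> \<int>" using open_contains_nonint[OF UV(2)] UV(3) by (metis mem_Times_iff)
    have "(x, y) \<in> region A" "(x, y) \<in> region B"
      using UV(4) x y interior_subset by (meson IntD1 IntD2 SigmaI subsetD)+
    then obtain c d where "c \<in> A" "d \<in> B" "(x, y) \<in> unit_square c" "(x, y) \<in> unit_square d"
      by (auto simp: region_def)
    with unit_square_floor[OF _ x(2) y(2)] AB show False by blast
  qed
qed

lemma domino_iff_region: "domino X \<longleftrightarrow> (\<exists>D\<in>dominoes. X = region D)"
proof -
  have "region {c, d} = unit_square c \<union> unit_square d" for c d by (simp add: region_def)
  then show ?thesis unfolding domino_def dominoes_def by blast
qed

lemma tilings_eq_matchings:
  "{T. domino_tiling (region A) T} = (`) region ` matchings A"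
proof (intro equalityI subsetI)
  fix T assume "T \<in> {T. domino_tiling (region A) T}"
  then have T: "\<And>X. X \<in> T \<Longrightarrow> domino X" "\<Union>T = region A"
    "pairwise (\<lambda>D E. interior D \<inter> interior E = {}) T" by (auto simp: domino_tiling_def)
  have region_squares: "region (squares_of X) = X" "squares_of X \<in> dominoes" if X: "X \<in> T" for X
  proof -
    from T(1)[OF X] obtain D where "D \<in> dominoes" "X = region D" unfolding domino_iff_region by blast
    then show "region (squares_of X) = X" "squares_of X \<in> dominoes" by (simp_all add: squares_of_region)
  qed
  define M where "M = squares_of ` T"
  have "region ` M = T"
    unfolding M_def image_image using region_squares(1) by simp
  moreover have "M \<in> matchings A"
    unfolding matchings_def mem_Collect_eq
  proof (intro conjI)
    show "M \<subseteq> dominoes" using region_squares(2) by (auto simp: M_def)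
    have "region (\<Union>M) = region A" unfolding region_Union \<open>region ` M = T\<close> T(2) ..
    then show "\<Union>M = A" by (simp only: region_inject)
    show "disjoint M"
    proof (rule disjointI)
      fix D E assume DE: "D \<in> M" "E \<in> M" "D \<noteq> E"
      then have "region D \<in> T" "region E \<in> T" "region D \<noteq> region E"
        using \<open>region ` M = T\<close> by (auto simp: region_inject)
      with T(3) have "interior (region D) \<inter> interior (region E) = {}" by (auto simp: pairwise_def)
      then show "D \<inter> E = {}" by (simp only: interior_region_disjoint_iff)
    qed
  qed
  ultimately show "T \<in> (`) region ` matchings A" by blast
next
  fix T assume "T \<in> (`) region ` matchings A"
  then obtain M where M: "M \<in> matchings A" "T = region ` M" by blast
  then have M': "M \<subseteq> dominoes" "\<Union>M = A" "disjoint M" by (auto simp: matchings_def)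
  have "\<forall>X\<in>T. domino X" using M'(1) unfolding M(2) domino_iff_region by blast
  moreover have "\<Union>T = region A" unfolding M(2) region_Union[symmetric] M'(2) ..
  moreover have "pairwise (\<lambda>D E. interior D \<inter> interior E = {}) T"
    unfolding pairwise_def
  proof (intro ballI impI)
    fix X Y assume XY: "X \<in> T" "Y \<in> T" "X \<noteq> Y"
    then obtain D E where DE: "D \<in> M" "E \<in> M" "X = region D" "Y = region E" unfolding M(2) by blast
    with XY have "D \<inter> E = {}" by (intro disjointD[OF M'(3)]) auto
    then show "interior X \<inter> interior Y = {}" unfolding DE(3,4) interior_region_disjoint_iff .
  qed
  ultimately show "T \<in> {T. domino_tiling (region A) T}" by (simp add: domino_tiling_def)
qed

lemma prob_tiling_contains:
  "measure_pmf.prob (pmf_of_set {T. domino_tiling (aztec_diamond n) T}) {T. region D \<in> T} = domino_prob n D"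
proof -
  let ?A = "aztec_squares n"
  have tilings: "{T. domino_tiling (aztec_diamond n) T} = (`) region ` matchings ?A"
    using tilings_eq_matchings[of ?A] by (simp add: aztec_diamond_def region_def)
  have inj: "inj region" by (intro injI) (simp only: region_inject)
  then have inj': "inj_on ((`) region) S" for S
    by (auto simp: inj_on_def inj_image_eq_iff)
  have "matchings ?A \<noteq> {}" using card_matchings_aztec_pos[of n] by auto
  then have "measure_pmf.prob (pmf_of_set ((`) region ` matchings ?A)) {T. region D \<in> T} =
      card ((`) region ` matchings ?A \<inter> {T. region D \<in> T}) / card ((`) region ` matchings ?A)"
    by (intro measure_pmf_of_set) (auto simp: finite_matchings finite_aztec_squares)
  also have "(`) region ` matchings ?A \<inter> {T. region D \<in> T} = (`) region ` {M \<in> matchings ?A. D \<in> M}"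
    using inj_image_mem_iff[OF inj] by blast
  finally show ?thesis
    unfolding tilings domino_prob_def by (simp add: card_image inj')
qed

lemma horizontal_domino_eq_region: "horizontal_domino l m = region (hdom l m)"
proof -
  have "{real_of_int l - 1..real_of_int l + 1} = {real_of_int (l - 1)..real_of_int (l - 1) + 1} \<union> {real_of_int l..real_of_int l + 1}"
    by auto
  then show ?thesis
    unfolding horizontal_domino_def region_def hdom_def unit_square_def by (simp add: Sigma_Un_distrib1)
qed

lemma placement_prob_eq:
  "placement_prob l m n = (if odd (l + m + int n) then hprob n l m else 0)"
proof -
  have "black n (l - 1, m) \<longleftrightarrow> odd (l + m + int n)"
    unfolding black_def fst_conv snd_conv by presburger
  then show ?thesis
    using prob_tiling_contains[of n "hdom l m"]
    by (simp add: placement_prob_def horizontal_domino_eq_region hprob_def)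
qed

text \<open>
  Containment in the diamond only gives \<open>\<bar>l\<bar> + \<bar>m\<bar> \<le> n\<close>; equality is excluded by the parity.
\<close>

lemma horizontal_domino_inside:
  assumes "horizontal_domino l m \<subseteq> aztec_diamond n" "odd (l + m + int n)"
  shows "Suc (nat (\<bar>l\<bar> + \<bar>m\<bar>)) \<le> n"
proof -
  have "squares_of (horizontal_domino l m) \<subseteq> squares_of (aztec_diamond n)"
    using assms(1) by (auto simp: squares_of_def)
  then have "hdom l m \<subseteq> aztec_squares n"
    using squares_of_region by (simp add: horizontal_domino_eq_region aztec_diamond_def flip: region_def)
  then have "(\<bar>l\<bar> + \<bar>m\<bar>) + (\<bar>l + 1\<bar> + \<bar>m + 1\<bar>) \<le> 2 * int n"
    "(\<bar>l - 1\<bar> + \<bar>m\<bar>) + (\<bar>l\<bar> + \<bar>m + 1\<bar>) \<le> 2 * int n"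
    using aztec_squares_alt[of l m n] aztec_squares_alt[of "l - 1" m n] by (simp_all add: hdom_def)
  then have "\<bar>l\<bar> + \<bar>m\<bar> \<le> int n" by linarith
  moreover have "\<bar>l\<bar> + \<bar>m\<bar> \<noteq> int n" using assms(2) by presburger
  ultimately show ?thesis by linarith
qed

section \<open>The placement probability at a fixed position\<close>

theorem theorem1p1:
  fixes l m :: int and \<alpha> :: nat
  assumes "\<alpha> \<in> {0, 1, 2, 3}"
  shows "\<exists>num den :: real poly. den \<noteq> 0 \<and>
    (\<forall>p n :: nat. n = 4 * p + \<alpha> \<longrightarrow>
      ([l + m = int \<alpha> + 1] (mod 2) \<longrightarrow> horizontal_domino l m \<subseteq> aztec_diamond n \<longrightarrow>
         poly den (real p) \<noteq> 0 \<and>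
         placement_prob l m n =
           1 / 4 + 2 powi (- 4 * int p - int \<alpha>) * (binom_2p_minus_1 p)\<^sup>2
             * (poly num (real p) / poly den (real p))) \<and>
      (\<not> [l + m = int \<alpha> + 1] (mod 2) \<longrightarrow> placement_prob l m n = 0))"
proof -
  let ?N = "Suc (nat (\<bar>l\<bar> + \<bar>m\<bar>))"
  have "\<alpha> < 4" using assms by auto
  then obtain f where "rational_on {p. ?N \<le> 4 * p + \<alpha>} f"
    and f: "\<And>p. ?N \<le> 4 * p + \<alpha> \<Longrightarrow> excess l m (4 * p + \<alpha>) = prob_weight p * f p"
    using rational_multipleE[OF excess_regular] by blast
  then obtain num den :: "real poly" where den: "den \<noteq> 0"
    and num: "\<And>p. ?N \<le> 4 * p + \<alpha> \<Longrightarrow> poly den (real p) \<noteq> 0 \<and> f p = poly num (real p) / poly den (real p)"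
    unfolding rational_on_def by blast
  have parity: "[l + m = int \<alpha> + 1] (mod 2) \<longleftrightarrow> odd (l + m + int (4 * p + \<alpha>))" for p
    unfolding cong_def by presburger
  have inside: "poly den (real p) \<noteq> 0 \<and> placement_prob l m (4 * p + \<alpha>) =
      1 / 4 + 2 powi (- 4 * int p - int \<alpha>) * (binom_2p_minus_1 p)\<^sup>2 * (poly (smult (2 ^ \<alpha>) num) (real p) / poly den (real p))"
    if odd: "odd (l + m + int (4 * p + \<alpha>))" and sub: "horizontal_domino l m \<subseteq> aztec_diamond (4 * p + \<alpha>)" for p
  proof -
    have N: "?N \<le> 4 * p + \<alpha>" using horizontal_domino_inside[OF sub odd] .
    have exponent: "(- 4 * int p - int \<alpha>) = - int (4 * p + \<alpha>)" by simp
    have "(2::real) powi (- 4 * int p - int \<alpha>) = 1 / (2 ^ (4 * p) * 2 ^ \<alpha>)"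
      unfolding exponent by (simp only: power_int_minus power_int_of_nat power_add inverse_eq_divide)
    also have "(2::real) ^ (4 * p) = 16 ^ p" by (simp add: power_mult)
    finally have power: "(2::real) powi (- 4 * int p - int \<alpha>) = 1 / (16 ^ p * 2 ^ \<alpha>)" .
    have "placement_prob l m (4 * p + \<alpha>) = 1 / 4 + excess l m (4 * p + \<alpha>)"
      unfolding placement_prob_eq excess_def if_P[OF odd] by simp
    also have "\<dots> = 1 / 4 + (binom_2p_minus_1 p)\<^sup>2 / 16 ^ p * (poly num (real p) / poly den (real p))"
      using f[OF N] num[OF N] by (simp only: prob_weight_eq)
    also have "\<dots> = 1 / 4 + 2 powi (- 4 * int p - int \<alpha>) * (binom_2p_minus_1 p)\<^sup>2 * (poly (smult (2 ^ \<alpha>) num) (real p) / poly den (real p))"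
      unfolding power by simp
    finally show ?thesis using num[OF N] by blast
  qed
  have outside: "placement_prob l m (4 * p + \<alpha>) = 0" if "\<not> odd (l + m + int (4 * p + \<alpha>))" for p
    unfolding placement_prob_eq using that by (simp only: if_False)
  show ?thesis
    by (rule exI[of _ "smult (2 ^ \<alpha>) num"], rule exI[of _ den]) (use den inside outside parity in blast)
qed

end
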